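(* Let $p$ be a prime number and let $K$ be a finite Galois extension of $\mathbb{Q}$ with infinite $p$-class field tower. Suppose that $K$ has a subfield $\widetilde{k}$ satisfying: (a) $\widetilde{k}$ is Galois over $\mathbb{Q}$; (b) $[\widetilde{k}:\mathbb{Q}]=q$, with $q$ a prime number. Let $K_0=K$ and, for $n\ge1$, let $K_n$ be the Hilbert $p$-class field of $K_{n-1}$. Let $G_n=\mathrm{Gal}(K_n/\mathbb{Q})$, $\widetilde{H}_n=\mathrm{Gal}(K_n/\widetilde{k})$ and let $\chi\in Irr(G_n)$. Then either (i) $Res_{\widetilde{H}_n}^{G_n}\chi=\theta$ for some $\theta\in Irr(\widetilde{H}_n)$, or (ii) $\chi=Ind_{\widetilde{H}_n}^{G_n}\theta$ for some $\theta\in Irr(\widetilde{H}_n)$.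
   Context: For a finite group $G$, $Irr(G)$ is the set of irreducible complex characters of $G$. For a subgroup $H$ of $G$, $Res_H^G\chi$ is the restriction to $H$ of a character $\chi$ of $G$, and $Ind_H^G\theta$ is the character of $G$ induced by a character $\theta$ of $H$. The Hilbert $p$-class field of a number field $F$ is the maximal unramified abelian extension of $F$ whose Galois group is a $p$-group. With $K_n$ as in the statement, $K$ has infinite $p$-class field tower if $K_n\ne K_{n-1}$ for all $n\ge 1$. Each $K_n$ is Galois over $\mathbb{Q}$ when $K$ is. *)

theory Defs
  imports
    "HOL-Algebra.Algebra"
    "HOL-Computational_Algebra.Polynomial"
    "Jordan_Normal_Form.VS_Connect"
begin

section \<open>Number fields inside the complex numbers\<close>

text \<open>
  The field of complex numbers contains an algebraic closure of the rationals; all number fields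
  are taken as subfields of it.
\<close>

abbreviation ring_on :: "complex set \<Rightarrow> complex ring" where
  "ring_on A \<equiv> class_ring\<lparr>carrier := A\<rparr>"

definition finite_extension :: "complex set \<Rightarrow> complex set \<Rightarrow> bool" where
  "finite_extension F L \<longleftrightarrow>
     subfield F class_ring \<and> subfield L class_ring \<and> F \<subseteq> L \<and> ring.finite_dimension class_ring F L"

definition degree_over :: "complex set \<Rightarrow> complex set \<Rightarrow> nat" where
  "degree_over F L = ring.dim class_ring F L"

text \<open>
  The group of automorphisms of \<open>L\<close> that fix \<open>F\<close> pointwise. As in \<^const>\<open>BijGroup\<close>, automorphisms
  are extensional functions on \<open>L\<close>, so that distinct elements differ on \<open>L\<close>.
\<close>

definition Gal :: "complex set \<Rightarrow> complex set \<Rightarrow> (complex \<Rightarrow> complex) monoid" where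
  "Gal L F = (BijGroup L)
     \<lparr>carrier := {\<sigma> \<in> Bij L \<inter> Ring.ring_hom (ring_on L) (ring_on L). \<forall>x\<in>F. \<sigma> x = x}\<rparr>"

definition finite_galois_extension :: "complex set \<Rightarrow> complex set \<Rightarrow> bool" where
  "finite_galois_extension F L \<longleftrightarrow>
     finite_extension F L \<and> {x \<in> L. \<forall>\<sigma>\<in>carrier (Gal L F). \<sigma> x = x} = F"


section \<open>Unramified extensions and the Hilbert p-class field\<close>

definition ring_of_integers :: "complex set \<Rightarrow> complex ring" where
  "ring_of_integers L = ring_on {x \<in> L. algebraic_int x}"

text \<open>
  For a nonzero prime \<open>P\<close> of \<open>L\<close>, lying over \<open>P \<inter> F\<close>: the exponent of \<open>P\<close> in the factorization of
  the extension of the ideal \<open>P \<inter> F\<close> to the ring of integers of \<open>L\<close>.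
\<close>

definition ramification_index :: "complex set \<Rightarrow> complex set \<Rightarrow> complex set \<Rightarrow> nat" where
  "ramification_index F L P =
     (GREATEST e::nat. (P [^]\<^bsub>ideals_set (ring_of_integers L)\<^esub> e)
        divides\<^bsub>ideals_set (ring_of_integers L)\<^esub> (genideal (ring_of_integers L) (P \<inter> F)))"

text \<open>Residue fields are finite, so no separability condition on them is needed.\<close>

definition unramified_at_finite_primes :: "complex set \<Rightarrow> complex set \<Rightarrow> bool" where
  "unramified_at_finite_primes F L \<longleftrightarrow>
     (\<forall>P. primeideal P (ring_of_integers L) \<and> P \<noteq> {0} \<longrightarrow> ramification_index F L P = 1)"

text \<open>No real place of \<open>F\<close> becomes complex in \<open>L\<close>.\<close>

definition unramified_at_infinite_primes :: "complex set \<Rightarrow> complex set \<Rightarrow> bool" where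
  "unramified_at_infinite_primes F L \<longleftrightarrow>
     (\<forall>\<tau> \<in> Ring.ring_hom (ring_on L) (class_ring :: complex ring). \<tau> ` F \<subseteq> \<real> \<longrightarrow> \<tau> ` L \<subseteq> \<real>)"

definition unramified_extension :: "complex set \<Rightarrow> complex set \<Rightarrow> bool" where
  "unramified_extension F L \<longleftrightarrow>
     unramified_at_finite_primes F L \<and> unramified_at_infinite_primes F L"

definition unramified_abelian_p_extension :: "nat \<Rightarrow> complex set \<Rightarrow> complex set \<Rightarrow> bool" where
  "unramified_abelian_p_extension p F L \<longleftrightarrow>
     finite_galois_extension F L \<and> comm_group (Gal L F) \<and> (\<exists>m. Coset.order (Gal L F) = p ^ m)
     \<and> unramified_extension F L"

text \<open>
  The compositum of two unramified abelian \<open>p\<close>-extensions is again one, so that the maximal one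
  is the greatest one.
\<close>

definition hilbert_p_class_field :: "nat \<Rightarrow> complex set \<Rightarrow> complex set \<Rightarrow> bool" where
  "hilbert_p_class_field p F L \<longleftrightarrow>
     unramified_abelian_p_extension p F L
     \<and> (\<forall>L'. unramified_abelian_p_extension p F L' \<longrightarrow> L' \<subseteq> L)"

definition p_class_field_tower :: "nat \<Rightarrow> complex set \<Rightarrow> (nat \<Rightarrow> complex set) \<Rightarrow> bool" where
  "p_class_field_tower p K T \<longleftrightarrow>
     T 0 = K \<and> (\<forall>n\<ge>1. hilbert_p_class_field p (T (n - 1)) (T n))"

definition infinite_p_class_field_tower :: "nat \<Rightarrow> complex set \<Rightarrow> bool" where
  "infinite_p_class_field_tower p K \<longleftrightarrow>
     (\<exists>T. p_class_field_tower p K T \<and> (\<forall>n\<ge>1. T n \<noteq> T (n - 1)))"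


section \<open>Complex characters of finite groups\<close>

definition GL :: "nat \<Rightarrow> complex mat monoid" where
  "GL d = units_of (ring_mat TYPE(complex) d ())"

definition irreducible_representation ::
    "('a, 'b) monoid_scheme \<Rightarrow> nat \<Rightarrow> ('a \<Rightarrow> complex mat) \<Rightarrow> bool" where
  "irreducible_representation G d \<rho> \<longleftrightarrow>
     d > 0 \<and> \<rho> \<in> hom G (GL d)
     \<and> (\<forall>W. subspace class_ring W (module_vec TYPE(complex) d)
            \<and> (\<forall>g\<in>carrier G. \<forall>w\<in>W. \<rho> g *\<^sub>v w \<in> W)
          \<longrightarrow> W = {0\<^sub>v d} \<or> W = carrier_vec d)"

definition mat_trace :: "complex mat \<Rightarrow> complex" where
  "mat_trace A = (\<Sum>i<dim_row A. A $$ (i, i))"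

text \<open>Characters are \<^const>\<open>undefined\<close> outside the carrier, so that their equality is equality on it.\<close>

definition Irr :: "('a, 'b) monoid_scheme \<Rightarrow> ('a \<Rightarrow> complex) set" where
  "Irr G = {\<chi>. \<exists>d \<rho>. irreducible_representation G d \<rho> \<and> \<chi> = (\<lambda>g\<in>carrier G. mat_trace (\<rho> g))}"

definition Res :: "('a, 'b) monoid_scheme \<Rightarrow> ('a \<Rightarrow> complex) \<Rightarrow> 'a \<Rightarrow> complex" where
  "Res H \<chi> = restrict \<chi> (carrier H)"

text \<open>
  For a subgroup \<open>H\<close> of a finite group \<open>G\<close>, this is the usual formula for the induced character,
  with \<open>\<theta>\<close> extended by zero outside \<open>H\<close>.
\<close>

definition Ind ::
    "('a, 'b) monoid_scheme \<Rightarrow> ('a, 'c) monoid_scheme \<Rightarrow> ('a \<Rightarrow> complex) \<Rightarrow> 'a \<Rightarrow> complex" where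
  "Ind G H \<theta> = (\<lambda>g\<in>carrier G.
     (\<Sum>x\<in>carrier G. if inv\<^bsub>G\<^esub> x \<otimes>\<^bsub>G\<^esub> g \<otimes>\<^bsub>G\<^esub> x \<in> carrier H
        then \<theta> (inv\<^bsub>G\<^esub> x \<otimes>\<^bsub>G\<^esub> g \<otimes>\<^bsub>G\<^esub> x) else 0) / of_nat (Coset.order H))"

end

theory Submission
  imports Defs "Jordan_Normal_Form.DL_Rank" "Jordan_Normal_Form.Spectral_Radius"
begin

text \<open>
  Put \<open>G = Gal(L/F)\<close> and \<open>H = Gal(L/k)\<close>, where \<open>L\<close> is a field of the tower and \<open>F = \<rat>\<close>.
  The field \<open>L\<close> is a finite extension of \<open>F\<close> that contains \<open>k\<close>, and the statement is Clifford
  theory for the subgroup \<open>H\<close>, which is normal of index \<open>1\<close> or \<open>q\<close>.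

  An automorphism of \<open>L\<close> maps the Galois extension \<open>k\<close> of \<open>F\<close> into itself, because an element
  \<open>x\<close> of \<open>k\<close> is a root of the product of all \<open>X - \<tau> x\<close> with \<open>\<tau>\<close> in \<open>Gal(k/F)\<close>, which has
  coefficients in \<open>F\<close> and all its roots in \<open>k\<close>. Hence restriction to \<open>k\<close> is a homomorphism from
  \<open>G\<close> to \<open>Gal(k/F)\<close> with kernel \<open>H\<close>. The latter group has order \<open>[k:F] = q\<close>
  (\<open>card_Gal_prime_degree\<close>), so it is cyclic and has a faithful character with values in the
  \<open>q\<close>-th roots of unity. Composing, \<open>H\<close> is the kernel of a linear character \<open>\<eta>\<close> of \<open>G\<close> with
  \<open>\<eta>\<^sup>q = 1\<close>. If \<open>\<eta>\<close> is trivial, then \<open>H = G\<close> and the first alternative holds.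

  Let \<open>\<eta>\<close> be nontrivial, and let \<open>\<rho>\<close> be an irreducible representation of \<open>G\<close> on \<open>V\<close> whose restriction
  to \<open>H\<close> leaves a proper nonzero subspace \<open>W\<close> invariant. Averaging the conjugates of a rank one
  matrix with image in \<open>W\<close>, with the powers of \<open>\<eta>\<close> as weights, gives for some \<open>0 < j < q\<close> a
  nonzero \<open>Q\<close> with \<open>\<rho>(g) Q = \<eta>(g)\<^sup>j Q \<rho>(g)\<close> (\<open>semi_invariant_exists\<close>): otherwise the
  average over \<open>H\<close> would be a multiple of the average over \<open>G\<close>, which is a scalar by Schur's lemma,
  but it has its image in \<open>W\<close> and its trace is not zero.

  By Schur's lemma again, \<open>Q\<^sup>q\<close> is a nonzero scalar, and after rescaling it is \<open>1\<close>. Now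
  \<open>G\<close> permutes the eigenspaces of \<open>Q\<close>, and \<open>H\<close> is the stabilizer of each of them. With
  \<open>E = (1/q) (1 + Q + \<dots> + Q\<^sup>q\<^sup>-\<^sup>1)\<close>, the projection to the eigenvalue \<open>1\<close>, this says that \<open>E\<close>
  commutes with \<open>\<rho>(H)\<close> and that \<open>E \<rho>(g) E = 0\<close> outside \<open>H\<close> (\<open>imprimitivity_idempotent\<close>). So
  \<open>\<rho>\<close> is induced from the action of \<open>H\<close> on the image of \<open>E\<close>, and this action is irreducible
  because \<open>\<rho>\<close> is (\<open>induced_from_char_kernel\<close>). No choice of coset representatives enters: everything
  is expressed by sums over \<open>G\<close>.
\<close>

section \<open>Sums of square matrices, traces and idempotents\<close>

lemma subspace_vec_iff:
  "subspace class_ring W (module_vec TYPE(complex) d) \<longleftrightarrow>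
     W \<subseteq> carrier_vec d \<and> 0\<^sub>v d \<in> W \<and> (\<forall>v\<in>W. \<forall>w\<in>W. v + w \<in> W) \<and> (\<forall>c. \<forall>v\<in>W. c \<cdot>\<^sub>v v \<in> W)"
  using vec_module[of d] vec_vs[of d]
  by (auto simp: VectorSpace.subspace_def submodule_def module_vec_simps)

lemma mult_square_mat_carrier [simp]:
  "A \<in> carrier_mat d d \<Longrightarrow> B \<in> carrier_mat d d \<Longrightarrow> (A :: complex mat) * B \<in> carrier_mat d d"
  by (rule mult_carrier_mat)

lemma mult_square_mat_vec_carrier [simp]:
  "A \<in> carrier_mat d d \<Longrightarrow> v \<in> carrier_vec d \<Longrightarrow> (A :: complex mat) *\<^sub>v v \<in> carrier_vec d"
  by (rule mult_mat_vec_carrier)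

text \<open>
  Matrices of varying size form no additive monoid, so the size of the sum is a parameter: it
  determines the value of the empty sum.
\<close>

definition mat_sum :: "nat \<Rightarrow> ('a \<Rightarrow> complex mat) \<Rightarrow> 'a set \<Rightarrow> complex mat" where
  "mat_sum d F S = mat d d (\<lambda>(i, j). \<Sum>s\<in>S. F s $$ (i, j))"

lemma mat_sum_carrier [simp]: "mat_sum d F S \<in> carrier_mat d d"
  by (simp add: mat_sum_def)

lemma mat_sum_dim [simp]: "dim_row (mat_sum d F S) = d" "dim_col (mat_sum d F S) = d"
  by (simp_all add: mat_sum_def)

lemma mat_sum_cong: "(\<And>s. s \<in> S \<Longrightarrow> F s = H s) \<Longrightarrow> mat_sum d F S = mat_sum d H S"
  by (simp add: mat_sum_def)

lemma mat_sum_mult_left: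
  assumes "A \<in> carrier_mat d d" "\<And>s. s \<in> S \<Longrightarrow> F s \<in> carrier_mat d d"
  shows "A * mat_sum d F S = mat_sum d (\<lambda>s. A * F s) S"
proof (rule eq_matI)
  fix i j assume ij: "i < dim_row (mat_sum d (\<lambda>s. A * F s) S)" "j < dim_col (mat_sum d (\<lambda>s. A * F s) S)"
  then have "(A * mat_sum d F S) $$ (i, j) = (\<Sum>l<d. A $$ (i, l) * (\<Sum>s\<in>S. F s $$ (l, j)))"
    using assms(1) by (simp add: mat_sum_def scalar_prod_def lessThan_atLeast0)
  also have "\<dots> = (\<Sum>s\<in>S. \<Sum>l<d. A $$ (i, l) * F s $$ (l, j))"
    unfolding sum_distrib_left by (rule sum.swap)
  also have "\<dots> = (\<Sum>s\<in>S. (A * F s) $$ (i, j))"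
  proof (rule sum.cong[OF refl])
    fix s assume "s \<in> S"
    from assms(2)[OF this] have "dim_row (F s) = d" "dim_col (F s) = d" by auto
    then show "(\<Sum>l<d. A $$ (i, l) * F s $$ (l, j)) = (A * F s) $$ (i, j)"
      using ij assms(1) by (simp add: scalar_prod_def lessThan_atLeast0)
  qed
  also have "\<dots> = mat_sum d (\<lambda>s. A * F s) S $$ (i, j)"
    using ij by (simp add: mat_sum_def)
  finally show "(A * mat_sum d F S) $$ (i, j) = mat_sum d (\<lambda>s. A * F s) S $$ (i, j)" .
qed (use assms in auto)

lemma mat_sum_mult_right:
  assumes "A \<in> carrier_mat d d" "\<And>s. s \<in> S \<Longrightarrow> F s \<in> carrier_mat d d"
  shows "mat_sum d F S * A = mat_sum d (\<lambda>s. F s * A) S"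
proof (rule eq_matI)
  fix i j assume ij: "i < dim_row (mat_sum d (\<lambda>s. F s * A) S)" "j < dim_col (mat_sum d (\<lambda>s. F s * A) S)"
  then have "(mat_sum d F S * A) $$ (i, j) = (\<Sum>l<d. (\<Sum>s\<in>S. F s $$ (i, l)) * A $$ (l, j))"
    using assms(1) by (simp add: mat_sum_def scalar_prod_def lessThan_atLeast0)
  also have "\<dots> = (\<Sum>s\<in>S. \<Sum>l<d. F s $$ (i, l) * A $$ (l, j))"
    unfolding sum_distrib_right by (rule sum.swap)
  also have "\<dots> = (\<Sum>s\<in>S. (F s * A) $$ (i, j))"
  proof (rule sum.cong[OF refl])
    fix s assume "s \<in> S"
    from assms(2)[OF this] have "dim_row (F s) = d" "dim_col (F s) = d" by auto
    then show "(\<Sum>l<d. F s $$ (i, l) * A $$ (l, j)) = (F s * A) $$ (i, j)"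
      using ij assms(1) by (simp add: scalar_prod_def lessThan_atLeast0)
  qed
  also have "\<dots> = mat_sum d (\<lambda>s. F s * A) S $$ (i, j)"
    using ij by (simp add: mat_sum_def)
  finally show "(mat_sum d F S * A) $$ (i, j) = mat_sum d (\<lambda>s. F s * A) S $$ (i, j)" .
qed (use assms in auto)

lemma mat_sum_smult:
  assumes "\<And>s. s \<in> S \<Longrightarrow> F s \<in> carrier_mat d d"
  shows "c \<cdot>\<^sub>m mat_sum d F S = mat_sum d (\<lambda>s. c \<cdot>\<^sub>m F s) S"
proof (rule eq_matI)
  fix i j assume ij: "i < dim_row (mat_sum d (\<lambda>s. c \<cdot>\<^sub>m F s) S)" "j < dim_col (mat_sum d (\<lambda>s. c \<cdot>\<^sub>m F s) S)"
  have "c * F s $$ (i, j) = (c \<cdot>\<^sub>m F s) $$ (i, j)" if "s \<in> S" for s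
    using assms[OF that] ij by auto
  then show "(c \<cdot>\<^sub>m mat_sum d F S) $$ (i, j) = mat_sum d (\<lambda>s. c \<cdot>\<^sub>m F s) S $$ (i, j)"
    using ij by (simp add: mat_sum_def sum_distrib_left)
qed auto

lemma mat_sum_smult_const:
  assumes "A \<in> carrier_mat d d"
  shows "mat_sum d (\<lambda>s. c s \<cdot>\<^sub>m A) S = (\<Sum>s\<in>S. c s) \<cdot>\<^sub>m A"
  using assms by (intro eq_matI) (auto simp: mat_sum_def sum_distrib_right)

lemma mat_sum_swap:
  "mat_sum d (\<lambda>s. mat_sum d (F s) T) S = mat_sum d (\<lambda>t. mat_sum d (\<lambda>s. F s t) S) T"
  by (rule eq_matI) (auto simp: mat_sum_def intro: sum.swap)

lemma mat_sum_reindex: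
  assumes "bij_betw h S T"
  shows "mat_sum d (\<lambda>s. F (h s)) S = mat_sum d F T"
  unfolding mat_sum_def
  by (rule cong_mat) (auto simp: sum.reindex_bij_betw[OF assms, symmetric])

lemma mat_sum_mono_neutral:
  assumes "finite S" "T \<subseteq> S" "\<And>s. s \<in> S - T \<Longrightarrow> F s = 0\<^sub>m d d"
  shows "mat_sum d F S = mat_sum d F T"
  unfolding mat_sum_def
  using assms by (intro cong_mat) (auto intro!: sum.mono_neutral_right)

lemma mat_sum_mult_vec_closed:
  assumes W: "subspace class_ring W (module_vec TYPE(complex) d)"
    and F: "\<And>s. s \<in> S \<Longrightarrow> F s \<in> carrier_mat d d" and v: "v \<in> carrier_vec d"
    and inW: "\<And>s. s \<in> S \<Longrightarrow> F s *\<^sub>v v \<in> W" and fin: "finite S"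
  shows "mat_sum d F S *\<^sub>v v \<in> W"
  using fin F inW
proof (induction S)
  case empty
  have "mat_sum d F {} *\<^sub>v v = 0\<^sub>v d"
    using v by (intro eq_vecI) (auto simp: mat_sum_def scalar_prod_def)
  then show ?case using W by (simp add: subspace_vec_iff)
next
  case (insert s S)
  have "mat_sum d F (insert s S) = F s + mat_sum d F S"
    using insert by (intro eq_matI) (auto simp: mat_sum_def)
  then have "mat_sum d F (insert s S) *\<^sub>v v = F s *\<^sub>v v + mat_sum d F S *\<^sub>v v"
    using insert(4) v by (simp add: add_mult_distrib_mat_vec[of _ d d])
  moreover have "mat_sum d F S *\<^sub>v v \<in> W" "F s *\<^sub>v v \<in> W"
    using insert by auto
  ultimately show ?case using W by (simp add: subspace_vec_iff)
qed

lemma mat_trace_comm: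
  assumes "A \<in> carrier_mat m n" "B \<in> carrier_mat n m"
  shows "mat_trace (A * B) = mat_trace (B * A)"
proof -
  have "mat_trace (A * B) = (\<Sum>i<m. \<Sum>j<n. A $$ (i, j) * B $$ (j, i))"
    using assms by (simp add: mat_trace_def scalar_prod_def lessThan_atLeast0)
  also have "\<dots> = (\<Sum>j<n. \<Sum>i<m. B $$ (j, i) * A $$ (i, j))"
    by (subst sum.swap) (simp add: mult.commute)
  also have "\<dots> = mat_trace (B * A)"
    using assms by (simp add: mat_trace_def scalar_prod_def lessThan_atLeast0)
  finally show ?thesis .
qed

lemma mat_trace_sum: "mat_trace (mat_sum d F S) = (\<Sum>s\<in>S. \<Sum>i<d. F s $$ (i, i))"
  by (simp add: mat_trace_def mat_sum_def) (rule sum.swap)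

lemma mat_trace_mat_sum:
  assumes "\<And>s. s \<in> S \<Longrightarrow> F s \<in> carrier_mat d d"
  shows "mat_trace (mat_sum d F S) = (\<Sum>s\<in>S. mat_trace (F s))"
  unfolding mat_trace_sum using assms by (intro sum.cong) (auto simp: mat_trace_def)

lemma mat_trace_smult: "mat_trace (c \<cdot>\<^sub>m A) = c * mat_trace A" if "A \<in> carrier_mat d d"
  using that by (simp add: mat_trace_def sum_distrib_left)

lemma smult_mat_assoc: "c \<cdot>\<^sub>m (k \<cdot>\<^sub>m A) = (c * k :: complex) \<cdot>\<^sub>m A"
  by (rule eq_matI) (auto simp: mult.assoc)

text \<open>
  The columns of \<open>B\<close> are a basis of the image of \<open>P\<close>, chosen among the columns of \<open>P\<close>, and \<open>C\<close>
  contains the coordinates of the columns of \<open>P\<close> in this basis. As \<open>P\<close> is the identity on its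
  image, \<open>B C B = P B = B\<close>, and \<open>B\<close> can be cancelled. In this way \<open>B\<close> and \<open>C\<close> identify the image
  of \<open>P\<close> with a coordinate space.
\<close>

lemma idempotent_factorization:
  assumes P: "(P :: complex mat) \<in> carrier_mat d d" and idem: "P * P = P"
  obtains e B C where "B \<in> carrier_mat d e" "C \<in> carrier_mat e d" "B * C = P" "C * B = 1\<^sub>m e"
proof -
  interpret vec_space "TYPE(complex)" d .
  obtain S where S: "maximal S (\<lambda>T. T \<subseteq> set (cols P) \<and> lin_indpt T)"
    using maximal_exists[of "(\<lambda>T. T \<subseteq> set (cols P) \<and> lin_indpt T)" "card (set (cols P))" "{}"]
    by (meson List.finite_set card_mono empty_iff empty_subsetI finite_lin_indpt2 finite.emptyI finite_subset)
  have sub: "S \<subseteq> set (cols P)" and ind: "lin_indpt S"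
    using S by (auto simp: maximal_def)
  have colsP: "set (cols P) \<subseteq> carrier_vec d" using P cols_dim by blast
  have finS: "finite S" using sub finite_subset by blast
  then obtain bs where bs: "set bs = S" "distinct bs" using finite_distinct_list by blast
  define e where "e = length bs"
  define B where "B = mat_of_cols d bs"
  have bsc: "set bs \<subseteq> carrier_vec d" using bs sub colsP by blast
  have B: "B \<in> carrier_mat d e" by (simp add: B_def e_def)
  have colsB: "cols B = bs" using bsc by (simp add: B_def)
  have inj: "v = 0\<^sub>v e" if "v \<in> carrier_vec e" "B *\<^sub>v v = 0\<^sub>v d" for v
    using lin_depI[OF B that(1) _ that(2)] ind bs colsB by metis
  have ex: "\<exists>c. c \<in> carrier_vec e \<and> col P j = B *\<^sub>v c" if j: "j < d" for j
  proof -
    have colj: "col P j \<in> set (cols P)" using P j by (metis carrier_matD(2) cols_length cols_nth nth_mem)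
    have "col P j \<in> span S"
    proof (rule ccontr)
      assume A: "col P j \<notin> span S"
      have Sc: "S \<subseteq> carrier_vec d" using sub colsP by blast
      have nS: "col P j \<notin> S" using A in_own_span[of S] Sc by auto
      have "lin_indpt (insert (col P j) S)"
        using lin_dep_iff_in_span[OF _ ind, of "col P j"] A colj Sc nS colsP by auto
      then have "insert (col P j) S = S"
        using S colj sub unfolding maximal_def by (metis insert_subset subset_insertI)
      then show False using nS by blast
    qed
    then obtain a where "col P j = lincomb a S"
      using finS bs bsc finite_span[of S] by (auto)
    then have "col P j = B *\<^sub>v vec e (\<lambda>i. a (col B i))"
      using mat_mult_eq_lincomb[OF B, of a] colsB bs by simp
    then show ?thesis by (intro exI[of _ "vec e (\<lambda>i. a (col B i))"]) auto
  qed
  then obtain c where c: "\<And>j. j < d \<Longrightarrow> c j \<in> carrier_vec e \<and> col P j = B *\<^sub>v c j" by metis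
  define C where "C = mat e d (\<lambda>(i, j). c j $ i)"
  have C: "C \<in> carrier_mat e d" by (simp add: C_def)
  have colC: "col C j = c j" if "j < d" for j
    using c[OF that] that by (intro eq_vecI) (auto simp: C_def)
  have BC: "B * C = P"
  proof (rule eq_matI)
    fix i j assume ij: "i < dim_row P" "j < dim_col P"
    then have "(B * C) $$ (i, j) = (B *\<^sub>v c j) $ i" using P B C colC by simp
    also have "\<dots> = P $$ (i, j)" using c[of j] ij P by (metis carrier_matD(2) index_col)
    finally show "(B * C) $$ (i, j) = P $$ (i, j)" .
  qed (use B C P in auto)
  have PB: "P * B = B"
  proof (rule eq_matI)
    fix i j assume ij: "i < dim_row B" "j < dim_col B"
    have "col B j \<in> set (cols P)" using ij B sub bs colsB
      by (metis cols_length cols_nth nth_mem subsetD)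
    then obtain l where l: "l < d" "col B j = col P l"
      using P by (metis carrier_matD(2) cols_length cols_nth in_set_conv_nth)
    have "(P * B) $$ (i, j) = (P *\<^sub>v col P l) $ i" using ij P B l by simp
    also have "\<dots> = (P * P) $$ (i, l)" using ij P B l by simp
    also have "\<dots> = col B j $ i" using idem l P B ij by simp
    finally show "(P * B) $$ (i, j) = B $$ (i, j)" using ij by simp
  qed (use P B in auto)
  have "C * B = 1\<^sub>m e"
  proof (rule eq_matI)
    fix i j assume ij: "i < dim_row (1\<^sub>m e)" "j < dim_col (1\<^sub>m e)"
    have "B *\<^sub>v (col (C * B) j - unit_vec e j) = B *\<^sub>v col (C * B) j - B *\<^sub>v unit_vec e j"
      using B C ij by (intro mult_minus_distrib_mat_vec) auto
    also have "B *\<^sub>v col (C * B) j = col (B * (C * B)) j" using B C ij by (intro eq_vecI) auto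
    also have "B * (C * B) = B" using BC PB B C by (metis assoc_mult_mat)
    also have "B *\<^sub>v unit_vec e j = col B j"
      using B ij by (intro eq_vecI) (auto simp: scalar_prod_right_unit)
    finally have "B *\<^sub>v (col (C * B) j - unit_vec e j) = 0\<^sub>v d" using B ij by auto
    then have "col (C * B) j - unit_vec e j = 0\<^sub>v e"
      using B C ij by (intro inj) auto
    then have "(col (C * B) j - unit_vec e j) $ i = 0" using ij by simp
    then show "(C * B) $$ (i, j) = 1\<^sub>m e $$ (i, j)" using ij B C by (auto simp: unit_vec_def)
  qed (use B C in auto)
  with B C BC show ?thesis using that by blast
qed

section \<open>Matrix representations and Schur's lemma\<close>

locale matrix_representation = group G for G (structure) +
  fixes d :: nat and \<rho> :: "'a \<Rightarrow> complex mat"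
  assumes finite_group: "finite (carrier G)"
    and hom_GL: "\<rho> \<in> hom G (GL d)"
begin

lemma GL_carrier: "A \<in> carrier (GL d) \<Longrightarrow> A \<in> carrier_mat d d"
  by (simp add: GL_def units_of_carrier Units_def ring_mat_def)

lemma rep_carrier [simp, intro]: "g \<in> carrier G \<Longrightarrow> \<rho> g \<in> carrier_mat d d"
  using hom_GL GL_carrier by (auto simp: hom_def)

lemma rep_mult: "g \<in> carrier G \<Longrightarrow> h \<in> carrier G \<Longrightarrow> \<rho> (g \<otimes> h) = \<rho> g * \<rho> h"
  using hom_GL by (auto simp: hom_def GL_def units_of_mult ring_mat_def)

lemma rep_one: "\<rho> \<one> = 1\<^sub>m d"
proof -
  interpret R: ring "ring_mat TYPE(complex) d ()" by (rule ring_mat)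
  have "\<rho> \<one> = \<one>\<^bsub>GL d\<^esub>"
    using hom_one[OF hom_GL is_group] R.units_group by (simp add: GL_def)
  then show ?thesis by (simp add: GL_def units_of_one ring_mat_def)
qed

lemma rep_inv_right: "g \<in> carrier G \<Longrightarrow> \<rho> g * \<rho> (inv g) = 1\<^sub>m d"
  using rep_mult[of g "inv g"] by (simp add: rep_one)

lemma rep_inv_left: "g \<in> carrier G \<Longrightarrow> \<rho> (inv g) * \<rho> g = 1\<^sub>m d"
  using rep_mult[of "inv g" g] by (simp add: rep_one)

definition conj_by :: "'a \<Rightarrow> complex mat \<Rightarrow> complex mat" where
  "conj_by g A = \<rho> g * A * \<rho> (inv g)"

lemma conj_by_carrier [simp]: "g \<in> carrier G \<Longrightarrow> A \<in> carrier_mat d d \<Longrightarrow> conj_by g A \<in> carrier_mat d d"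
  by (auto simp: conj_by_def intro!: mult_carrier_mat[of _ d d])

lemma conj_by_commute:
  assumes "g \<in> carrier G" "A \<in> carrier_mat d d"
  shows "conj_by g A * \<rho> g = \<rho> g * A"
proof -
  have "conj_by g A * \<rho> g = \<rho> g * A * (\<rho> (inv g) * \<rho> g)"
    unfolding conj_by_def using assms by (intro assoc_mult_mat[of _ d d _ d _ d]) auto
  then show ?thesis using assms by (simp add: rep_inv_left)
qed

lemma conj_by_mult:
  assumes "g \<in> carrier G" "h \<in> carrier G" "A \<in> carrier_mat d d"
  shows "conj_by (g \<otimes> h) A * \<rho> g = \<rho> g * conj_by h A"
proof -
  have "conj_by (g \<otimes> h) A = \<rho> g * \<rho> h * A * (\<rho> (inv h) * \<rho> (inv g))"
    using assms by (simp add: conj_by_def rep_mult inv_mult_group)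
  also have "\<dots> = \<rho> g * conj_by h A * \<rho> (inv g)"
    using assms by (simp add: conj_by_def assoc_mult_mat[of _ d d _ d _ d])
  also have "\<dots> * \<rho> g = \<rho> g * conj_by h A"
    using conj_by_commute[of g "conj_by h A"] assms by (simp add: conj_by_def[of g])
  finally show ?thesis .
qed

lemma trace_conj_by:
  assumes "g \<in> carrier G" "A \<in> carrier_mat d d"
  shows "mat_trace (conj_by g A) = mat_trace A"
proof -
  have "mat_trace (conj_by g A) = mat_trace (\<rho> (inv g) * (\<rho> g * A))"
    unfolding conj_by_def using assms by (intro mat_trace_comm[of _ d d]) auto
  also have "\<rho> (inv g) * (\<rho> g * A) = \<rho> (inv g) * \<rho> g * A"
    using assms by (intro assoc_mult_mat[symmetric, of _ d d _ d _ d]) auto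
  finally show ?thesis using assms by (simp add: rep_inv_left)
qed

text \<open>
  Substituting \<open>h g\<close> for \<open>g\<close> in the sum changes each conjugate by \<open>\<rho> h\<close> and each weight by the
  factor \<open>k\<close>. The constant weights give the usual average, which commutes with the representation; the
  inverse of a linear character as weight gives a matrix that commutes with it up to this character.
\<close>

lemma twisted_average_semi_invariant:
  assumes P: "P \<in> carrier_mat d d" and h: "h \<in> carrier G"
    and c: "\<And>g. g \<in> carrier G \<Longrightarrow> c g = k * c (h \<otimes> g)"
  defines "Q \<equiv> mat_sum d (\<lambda>g. c g \<cdot>\<^sub>m conj_by g P) (carrier G)"
  shows "\<rho> h * Q = k \<cdot>\<^sub>m (Q * \<rho> h)"
proof -
  have "\<rho> h * Q = mat_sum d (\<lambda>g. \<rho> h * (c g \<cdot>\<^sub>m conj_by g P)) (carrier G)"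
    unfolding Q_def using P h by (intro mat_sum_mult_left) auto
  also have "\<dots> = mat_sum d (\<lambda>g. k \<cdot>\<^sub>m (c (h \<otimes> g) \<cdot>\<^sub>m conj_by (h \<otimes> g) P * \<rho> h)) (carrier G)"
    using P h by (intro mat_sum_cong)
      (simp add: mult_smult_distrib[of _ d d _ d] mult_smult_assoc_mat[of _ d d _ d] conj_by_mult
        smult_mat_assoc c[symmetric])
  also have "\<dots> = mat_sum d (\<lambda>g. k \<cdot>\<^sub>m (c g \<cdot>\<^sub>m conj_by g P * \<rho> h)) (carrier G)"
  proof (rule mat_sum_reindex[where h = "\<lambda>g. h \<otimes> g"])
    show "bij_betw (\<lambda>g. h \<otimes> g) (carrier G) (carrier G)"
      using h by (intro bij_betw_byWitness[where f' = "\<lambda>g. inv h \<otimes> g"])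
        (auto simp: m_assoc[symmetric])
  qed
  also have "\<dots> = k \<cdot>\<^sub>m (Q * \<rho> h)"
    unfolding Q_def using P h
    by (subst mat_sum_mult_right[OF rep_carrier[OF h]], simp, subst mat_sum_smult) auto
  finally show ?thesis .
qed

end

locale irreducible_matrix_representation = matrix_representation +
  assumes dim_pos: "d > 0"
    and irreducible: "\<And>W. subspace class_ring W (module_vec TYPE(complex) d) \<Longrightarrow>
      (\<And>g w. g \<in> carrier G \<Longrightarrow> w \<in> W \<Longrightarrow> \<rho> g *\<^sub>v w \<in> W) \<Longrightarrow> W = {0\<^sub>v d} \<or> W = carrier_vec d"
begin

text \<open>
  The kernel of \<open>Q\<close> is an invariant subspace.
\<close>

lemma semi_invariant_injective:
  assumes Q: "Q \<in> carrier_mat d d" "Q \<noteq> 0\<^sub>m d d"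
    and semi: "\<And>g. g \<in> carrier G \<Longrightarrow> \<exists>k. Q * \<rho> g = k \<cdot>\<^sub>m (\<rho> g * Q)"
    and v: "v \<in> carrier_vec d" "Q *\<^sub>v v = 0\<^sub>v d"
  shows "v = 0\<^sub>v d"
proof -
  define W where "W = {v \<in> carrier_vec d. Q *\<^sub>v v = 0\<^sub>v d}"
  have sub: "subspace class_ring W (module_vec TYPE(complex) d)"
    using Q by (auto simp: subspace_vec_iff W_def mult_add_distrib_mat_vec[of _ d d]
      mult_mat_vec[of _ d d])
  have inv: "\<rho> g *\<^sub>v w \<in> W" if g: "g \<in> carrier G" and w: "w \<in> W" for g w
  proof -
    obtain k where k: "Q * \<rho> g = k \<cdot>\<^sub>m (\<rho> g * Q)" using semi g by blast
    have "Q *\<^sub>v (\<rho> g *\<^sub>v w) = (Q * \<rho> g) *\<^sub>v w"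
      using Q g w by (intro assoc_mult_mat_vec[symmetric, of _ d d _ d]) (auto simp: W_def)
    also have "\<dots> = k \<cdot>\<^sub>v ((\<rho> g * Q) *\<^sub>v w)"
      unfolding k using Q g w rep_carrier[OF g] by (intro eq_vecI) (auto simp: W_def)
    also have "(\<rho> g * Q) *\<^sub>v w = \<rho> g *\<^sub>v (Q *\<^sub>v w)"
      using Q g w by (intro assoc_mult_mat_vec[of _ d d _ d]) (auto simp: W_def)
    also have "k \<cdot>\<^sub>v (\<rho> g *\<^sub>v (Q *\<^sub>v w)) = 0\<^sub>v d"
      using w rep_carrier[OF g] by (intro eq_vecI) (auto simp: W_def scalar_prod_def)
    finally show ?thesis using w g by (auto simp: W_def)
  qed
  have "W \<noteq> carrier_vec d"
  proof
    assume W: "W = carrier_vec d"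
    have "Q = 0\<^sub>m d d"
    proof (rule eq_matI)
      fix i j assume ij: "i < dim_row (0\<^sub>m d d :: complex mat)" "j < dim_col (0\<^sub>m d d :: complex mat)"
      have "unit_vec d j \<in> W" using W by simp
      then have "(Q *\<^sub>v unit_vec d j) $ i = 0" using ij by (simp add: W_def)
      then show "Q $$ (i, j) = 0\<^sub>m d d $$ (i, j)" using ij Q by simp
    qed (use Q in auto)
    with Q show False by blast
  qed
  then have "W = {0\<^sub>v d}" using irreducible[OF sub] inv by blast
  then show ?thesis using v by (auto simp: W_def)
qed

text \<open>
  If \<open>c\<close> is an eigenvalue, then \<open>Z - c\<close> commutes with the representation and is not injective, so
  it vanishes.
\<close>

lemma schur:
  assumes Z: "Z \<in> carrier_mat d d" and comm: "\<And>g. g \<in> carrier G \<Longrightarrow> \<rho> g * Z = Z * \<rho> g"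
  obtains c where "Z = c \<cdot>\<^sub>m 1\<^sub>m d"
proof -
  obtain c where "c \<in> spectrum Z" using spectrum_non_empty[OF Z dim_pos] by blast
  then obtain v where v: "v \<in> carrier_vec d" "v \<noteq> 0\<^sub>v d" "Z *\<^sub>v v = c \<cdot>\<^sub>v v"
    using Z by (auto simp: spectrum_def eigenvalue_def eigenvector_def)
  define Q where "Q = Z - c \<cdot>\<^sub>m 1\<^sub>m d"
  have Q: "Q \<in> carrier_mat d d" using Z by (auto simp: Q_def intro!: minus_carrier_mat)
  have "Q *\<^sub>v v = Z *\<^sub>v v - (c \<cdot>\<^sub>m 1\<^sub>m d) *\<^sub>v v"
    unfolding Q_def using Z v by (intro minus_mult_distrib_mat_vec) auto
  also have "(c \<cdot>\<^sub>m 1\<^sub>m d) *\<^sub>v v = c \<cdot>\<^sub>v v" using v by (intro eq_vecI) auto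
  finally have Xv: "Q *\<^sub>v v = 0\<^sub>v d" using v by simp
  have "Q = 0\<^sub>m d d"
  proof (rule ccontr)
    assume nz: "Q \<noteq> 0\<^sub>m d d"
    have "Q * \<rho> g = 1 \<cdot>\<^sub>m (\<rho> g * Q)" if g: "g \<in> carrier G" for g
    proof -
      have "Q * \<rho> g = Z * \<rho> g - c \<cdot>\<^sub>m 1\<^sub>m d * \<rho> g"
        unfolding Q_def using Z g by (intro minus_mult_distrib_mat[of _ d d]) auto
      also have "c \<cdot>\<^sub>m 1\<^sub>m d * \<rho> g = \<rho> g * (c \<cdot>\<^sub>m 1\<^sub>m d)"
        using rep_carrier[OF g]
        by (simp add: mult_smult_distrib[of _ d d _ d] mult_smult_assoc_mat[of _ d d _ d])
      also have "Z * \<rho> g - \<rho> g * (c \<cdot>\<^sub>m 1\<^sub>m d) = \<rho> g * Q"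
        unfolding Q_def comm[OF g, symmetric] using Z g
        by (intro mult_minus_distrib_mat[symmetric, of _ d d]) auto
      finally show ?thesis by (auto simp: smult_mat_def)
    qed
    then have "v = 0\<^sub>v d" using semi_invariant_injective[OF Q nz _ v(1) Xv] by blast
    with v show False by blast
  qed
  have "Z = c \<cdot>\<^sub>m 1\<^sub>m d"
  proof (rule eq_matI)
    fix i j assume ij: "i < dim_row (c \<cdot>\<^sub>m 1\<^sub>m d)" "j < dim_col (c \<cdot>\<^sub>m 1\<^sub>m d)"
    then have "Q $$ (i, j) = 0" using \<open>Q = 0\<^sub>m d d\<close> by simp
    then show "Z $$ (i, j) = (c \<cdot>\<^sub>m 1\<^sub>m d) $$ (i, j)" using ij Z by (simp add: Q_def)
  qed (use Z in auto)
  then show ?thesis using that by blast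
qed

end

section \<open>Restriction to the kernel of a character of prime order\<close>

lemma sum_powers_root_of_unity:
  fixes z :: complex
  assumes "z ^ q = 1"
  shows "(\<Sum>j<q. z ^ j) = (if z = 1 then of_nat q else 0)"
  using assms geometric_sum[of z q] by auto

lemma prime_root_of_unity_pow_eq_1:
  fixes z :: complex
  assumes "Factorial_Ring.prime q" "z ^ q = 1" and j: "0 < j" "j < q" and 1: "z ^ j = 1"
  shows "z = 1"
proof -
  have "coprime j q"
    using assms by (metis coprime_commute nat_dvd_not_less prime_imp_coprime)
  then obtain x y where xy: "j * x = q * y + 1"
    using bezout_nat[of j q] j by (metis coprime_imp_gcd_eq_1 neq0_conv)
  have "z = z ^ (q * y + 1)" by (simp add: power_mult assms)
  also have "\<dots> = 1" unfolding xy[symmetric] by (simp add: power_mult 1)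
  finally show "z = 1" .
qed

lemma sum_shift_periodic:
  fixes f :: "nat \<Rightarrow> complex"
  assumes "f q = f 0"
  shows "(\<Sum>i<q. f (Suc i)) = (\<Sum>i<q. f i)"
  using assms sum.lessThan_Suc[of f q] sum.lessThan_Suc_shift[of f q] by simp

locale character_of_prime_order = irreducible_matrix_representation +
  fixes \<eta> :: "'a \<Rightarrow> complex" and q :: nat
  assumes q_prime: "Factorial_Ring.prime q"
    and char_mult: "\<And>g h. g \<in> carrier G \<Longrightarrow> h \<in> carrier G \<Longrightarrow> \<eta> (g \<otimes> h) = \<eta> g * \<eta> h"
    and char_pow: "\<And>g. g \<in> carrier G \<Longrightarrow> \<eta> g ^ q = 1"
    and char_nontrivial: "\<exists>g\<in>carrier G. \<eta> g \<noteq> 1"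
begin

definition char_kernel :: "'a set" where "char_kernel = {g \<in> carrier G. \<eta> g = 1}"

lemma q_pos: "q > 0" using q_prime prime_gt_0_nat by blast

lemma char_nonzero: "g \<in> carrier G \<Longrightarrow> \<eta> g \<noteq> 0"
  using char_pow[of g] q_pos by (auto simp: power_0_left)

lemma char_one: "\<eta> \<one> = 1"
  using char_mult[of \<one> \<one>] char_nonzero[of \<one>] by simp

lemma char_inv: "g \<in> carrier G \<Longrightarrow> \<eta> (inv g) = inverse (\<eta> g)"
  using char_mult[of "inv g" g] char_nonzero[of g] by (simp add: char_one inverse_eq_divide eq_divide_eq)

lemma one_in_char_kernel: "\<one> \<in> char_kernel" by (simp add: char_kernel_def char_one)

lemma finite_char_kernel: "finite char_kernel" using finite_group by (simp add: char_kernel_def)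

lemma card_char_kernel_pos: "card char_kernel > 0" using one_in_char_kernel finite_char_kernel card_gt_0_iff by blast

lemma char_pow_eq_1_iff:
  assumes "g \<in> carrier G" "0 < j" "j < q"
  shows "\<eta> g ^ j = 1 \<longleftrightarrow> \<eta> g = 1"
  using prime_root_of_unity_pow_eq_1[OF q_prime char_pow[OF assms(1)] assms(2,3)] by auto

text \<open>
  The matrix \<open>P\<close> is \<open>w w\<^sup>*\<close> for a nonzero \<open>w\<close> in \<open>W\<close>: its image is in \<open>W\<close> and its trace is
  not zero. The average \<open>Y\<close> of its conjugates by the kernel of \<open>\<eta>\<close> inherits both properties.
  By orthogonality of the powers of \<open>\<eta>\<close>, the matrix \<open>q Y\<close> is the sum of the \<open>Q j\<close> for \<open>j < q\<close>,
  the averages over \<open>G\<close> weighted with the powers of \<open>\<eta>\<close>. If all of them but \<open>Q 0\<close> vanished,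
  then \<open>Y\<close> would be a scalar by Schur's lemma, and a nonzero one by its trace, so \<open>W\<close> would be
  the whole space.
\<close>

lemma semi_invariant_exists:
  assumes W: "subspace class_ring W (module_vec TYPE(complex) d)" "W \<noteq> {0\<^sub>v d}" "W \<noteq> carrier_vec d"
    and inv: "\<And>g w. g \<in> char_kernel \<Longrightarrow> w \<in> W \<Longrightarrow> \<rho> g *\<^sub>v w \<in> W"
  obtains j Q where "0 < j" "j < q" "Q \<in> carrier_mat d d" "Q \<noteq> 0\<^sub>m d d"
    "\<And>g. g \<in> carrier G \<Longrightarrow> \<rho> g * Q = \<eta> g ^ j \<cdot>\<^sub>m (Q * \<rho> g)"
proof -
  obtain w where w: "w \<in> W" "w \<noteq> 0\<^sub>v d" using W by (auto simp: subspace_vec_iff)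
  have wc: "w \<in> carrier_vec d" using w W by (auto simp: subspace_vec_iff)
  define P where "P = mat d d (\<lambda>(a, b). w $ a * cnj (w $ b))"
  have P: "P \<in> carrier_mat d d" by (simp add: P_def)
  have PW: "P *\<^sub>v v \<in> W" if v: "v \<in> carrier_vec d" for v
  proof -
    have "P *\<^sub>v v = (\<Sum>b<d. cnj (w $ b) * v $ b) \<cdot>\<^sub>v w"
      using v wc by (intro eq_vecI)
        (auto simp: P_def scalar_prod_def lessThan_atLeast0 sum_distrib_right sum_distrib_left mult_ac)
    then show ?thesis using W w by (simp add: subspace_vec_iff)
  qed
  have trP: "mat_trace P \<noteq> 0"
  proof -
    obtain a where a: "a < d" "w $ a \<noteq> 0" using w wc by (metis eq_vecI carrier_vecD index_zero_vec)
    have "mat_trace P = of_real (\<Sum>b<d. (cmod (w $ b))\<^sup>2)"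
      unfolding of_real_sum complex_norm_square by (simp add: mat_trace_def P_def)
    moreover have "(\<Sum>b<d. (cmod (w $ b))\<^sup>2) > 0"
      using a by (intro sum_pos2[of _ a]) auto
    ultimately show ?thesis by (metis less_irrefl of_real_eq_0_iff)
  qed
  define c where "c j g = inverse (\<eta> g) ^ j" for j g
  define Q where "Q j = mat_sum d (\<lambda>g. c j g \<cdot>\<^sub>m conj_by g P) (carrier G)" for j
  have Q: "Q j \<in> carrier_mat d d" for j by (simp add: Q_def)
  have semi: "\<rho> h * Q j = \<eta> h ^ j \<cdot>\<^sub>m (Q j * \<rho> h)" if h: "h \<in> carrier G" for h j
    unfolding Q_def using h P
    by (intro twisted_average_semi_invariant)
      (auto simp: c_def char_mult char_nonzero power_mult_distrib power_inverse field_simps)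
  have "\<exists>j. 0 < j \<and> j < q \<and> Q j \<noteq> 0\<^sub>m d d"
  proof (rule ccontr)
    assume none: "\<not> ?thesis"
    define Y where "Y = mat_sum d (\<lambda>g. conj_by g P) char_kernel"
    have Y: "Y \<in> carrier_mat d d" by (simp add: Y_def)
    have "Q 0 = mat_sum d Q {0}"
      by (rule eq_matI) (use Q[of 0] in \<open>auto simp: mat_sum_def\<close>)
    also have "\<dots> = mat_sum d Q {..<q}"
      using none q_pos by (intro mat_sum_mono_neutral[symmetric]) auto
    also have "\<dots> = mat_sum d (\<lambda>g. (\<Sum>j<q. c j g) \<cdot>\<^sub>m conj_by g P) (carrier G)"
      unfolding Q_def by (subst mat_sum_swap) (auto intro!: mat_sum_cong simp: mat_sum_smult_const P)
    also have "\<dots> = mat_sum d (\<lambda>g. (if \<eta> g = 1 then of_nat q else 0) \<cdot>\<^sub>m conj_by g P) (carrier G)"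
    proof (rule mat_sum_cong)
      fix g assume g: "g \<in> carrier G"
      have "(\<Sum>j<q. c j g) = (if \<eta> g = 1 then of_nat q else 0)"
        unfolding c_def using sum_powers_root_of_unity[of "inverse (\<eta> g)" q] char_pow[OF g]
        by (simp add: power_inverse)
      then show "(\<Sum>j<q. c j g) \<cdot>\<^sub>m conj_by g P = (if \<eta> g = 1 then of_nat q else 0) \<cdot>\<^sub>m conj_by g P"
        by simp
    qed
    also have "\<dots> = mat_sum d (\<lambda>g. (if \<eta> g = 1 then of_nat q else 0) \<cdot>\<^sub>m conj_by g P) char_kernel"
    proof (intro mat_sum_mono_neutral)
      fix s assume s: "s \<in> carrier G - char_kernel"
      have "conj_by s P \<in> carrier_mat d d" using s P by simp
      then show "(if \<eta> s = 1 then of_nat q else 0) \<cdot>\<^sub>m conj_by s P = 0\<^sub>m d d"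
        using s by (intro eq_matI) (auto simp: char_kernel_def)
    qed (use finite_group in \<open>auto simp: char_kernel_def\<close>)
    also have "\<dots> = mat_sum d (\<lambda>g. of_nat q \<cdot>\<^sub>m conj_by g P) char_kernel"
      by (rule mat_sum_cong) (simp add: char_kernel_def)
    also have "\<dots> = of_nat q \<cdot>\<^sub>m Y"
      unfolding Y_def using P by (intro mat_sum_smult[symmetric]) (auto simp: char_kernel_def)
    finally have Q0: "Q 0 = of_nat q \<cdot>\<^sub>m Y" .
    have "\<rho> h * Q 0 = Q 0 * \<rho> h" if "h \<in> carrier G" for h
      using semi[OF that, of 0] by (auto simp: smult_mat_def)
    then obtain k where k: "Q 0 = k \<cdot>\<^sub>m 1\<^sub>m d" using schur[OF Q] by blast
    have "mat_trace (Q 0) = of_nat q * (of_nat (card char_kernel) * mat_trace P)"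
    proof -
      have "mat_trace Y = (\<Sum>g\<in>char_kernel. mat_trace (conj_by g P))"
        unfolding Y_def using P by (intro mat_trace_mat_sum) (auto simp: char_kernel_def)
      also have "\<dots> = of_nat (card char_kernel) * mat_trace P"
        using P by (simp add: trace_conj_by char_kernel_def)
      finally show ?thesis using Q0 mat_trace_smult[OF Y] by simp
    qed
    then have "mat_trace (Q 0) \<noteq> 0" using trP q_pos card_char_kernel_pos by simp
    then have k0: "k \<noteq> 0" unfolding k by (auto simp: mat_trace_def)
    have YW: "Y *\<^sub>v v \<in> W" if v: "v \<in> carrier_vec d" for v
      unfolding Y_def
    proof (rule mat_sum_mult_vec_closed[OF W(1) _ v _ finite_char_kernel])
      fix g assume g: "g \<in> char_kernel"
      then have gG: "g \<in> carrier G" by (simp add: char_kernel_def)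
      show "conj_by g P \<in> carrier_mat d d" using gG P by simp
      have "conj_by g P *\<^sub>v v = \<rho> g *\<^sub>v (P *\<^sub>v (\<rho> (inv g) *\<^sub>v v))"
        unfolding conj_by_def using gG P v by (simp add: assoc_mult_mat_vec[of _ d d _ d])
      then show "conj_by g P *\<^sub>v v \<in> W" using inv[OF g] PW gG v by simp
    qed
    have "v \<in> W" if v: "v \<in> carrier_vec d" for v
    proof -
      have "v = inverse k \<cdot>\<^sub>v ((k \<cdot>\<^sub>m 1\<^sub>m d) *\<^sub>v v)"
        using v k0 by (intro eq_vecI) auto
      also have "(k \<cdot>\<^sub>m 1\<^sub>m d) *\<^sub>v v = of_nat q \<cdot>\<^sub>v (Y *\<^sub>v v)"
        unfolding k[symmetric] Q0 using Y v by (intro eq_vecI) auto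
      finally show ?thesis using YW[OF v] W(1) unfolding subspace_vec_iff by metis
    qed
    then have "W = carrier_vec d" using W(1) unfolding subspace_vec_iff by blast
    with W(3) show False by blast
  qed
  with that Q semi show ?thesis by blast
qed

text \<open>
  By Schur's lemma \<open>Q\<^sup>q\<close> is a scalar; it is not zero because \<open>Q\<close> is injective, and so \<open>T = r Q\<close>
  satisfies \<open>T\<^sup>q = 1\<close> for a suitable number \<open>r\<close>. The average \<open>E\<close> of the powers \<open>R i = T\<^sup>i\<close> is
  the projection to the eigenspace of \<open>T\<close> for the eigenvalue \<open>1\<close>. Moving \<open>T\<close> through
  \<open>\<rho> g\<close> costs the factor \<open>\<eta>(g)\<^sup>j\<close>, and this is different from \<open>1\<close> outside the kernel, because \<open>\<eta>\<close>
  has prime order. This yields \<open>E \<rho>(g) E = 0\<close> there. For the same reason the powers \<open>T\<^sup>i\<close> with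
  \<open>0 < i < q\<close> have trace zero, being conjugate to proper multiples of themselves; so the trace of
  \<open>E\<close> is \<open>d/q\<close>.
\<close>

lemma imprimitivity_idempotent:
  assumes j: "0 < j" "j < q" and Q: "Q \<in> carrier_mat d d" "Q \<noteq> 0\<^sub>m d d"
    and semi: "\<And>g. g \<in> carrier G \<Longrightarrow> \<rho> g * Q = \<eta> g ^ j \<cdot>\<^sub>m (Q * \<rho> g)"
  obtains E where "E \<in> carrier_mat d d" "E * E = E" "mat_trace E \<noteq> 0"
    "\<And>g. g \<in> char_kernel \<Longrightarrow> \<rho> g * E = E * \<rho> g"
    "\<And>g. g \<in> carrier G \<Longrightarrow> g \<notin> char_kernel \<Longrightarrow> E * (\<rho> g * E) = 0\<^sub>m d d"
proof -
  have semi_pow: "\<rho> g * Q ^\<^sub>m i = \<eta> g ^ (j * i) \<cdot>\<^sub>m (Q ^\<^sub>m i * \<rho> g)" if g: "g \<in> carrier G" for g i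
  proof (induction i)
    case 0
    show ?case using rep_carrier[OF g] Q by (auto intro!: eq_matI)
  next
    case (Suc i)
    have Qi: "Q ^\<^sub>m i \<in> carrier_mat d d" using Q by simp
    have "\<rho> g * Q ^\<^sub>m Suc i = \<rho> g * Q ^\<^sub>m i * Q"
      using g Q Qi by (simp add: assoc_mult_mat[of _ d d _ d _ d])
    also have "\<dots> = \<eta> g ^ (j * i) \<cdot>\<^sub>m (Q ^\<^sub>m i * (\<rho> g * Q))"
      unfolding Suc using g Q Qi
      by (simp add: mult_smult_assoc_mat[of _ d d _ d] assoc_mult_mat[of _ d d _ d _ d])
    also have "\<dots> = \<eta> g ^ (j * Suc i) \<cdot>\<^sub>m (Q ^\<^sub>m Suc i * \<rho> g)"
      unfolding semi[OF g] using g Q Qi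
      by (simp add: mult_smult_distrib[of _ d d _ d] assoc_mult_mat[of _ d d _ d _ d]
        smult_mat_assoc power_add mult.commute)
    finally show ?case .
  qed
  have inj: "v = 0\<^sub>v d" if "v \<in> carrier_vec d" "Q *\<^sub>v v = 0\<^sub>v d" for v
  proof (rule semi_invariant_injective[OF Q _ that])
    fix g assume g: "g \<in> carrier G"
    have "Q * \<rho> g = inverse (\<eta> g ^ j) \<cdot>\<^sub>m (\<rho> g * Q)"
      unfolding semi[OF g] smult_mat_assoc using char_nonzero[OF g] by (auto simp: smult_mat_def)
    then show "\<exists>k. Q * \<rho> g = k \<cdot>\<^sub>m (\<rho> g * Q)" by blast
  qed
  have inj_pow: "v = 0\<^sub>v d" if v: "v \<in> carrier_vec d" "Q ^\<^sub>m i *\<^sub>v v = 0\<^sub>v d" for v i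
    using v
  proof (induction i arbitrary: v)
    case 0
    have "dim_row Q = d" using Q by simp
    with 0 show ?case by simp
  next
    case (Suc i)
    have v: "v \<in> carrier_vec d" by (rule Suc.prems(1))
    have z: "Q ^\<^sub>m Suc i *\<^sub>v v = Q ^\<^sub>m i *\<^sub>v (Q *\<^sub>v v)"
      using v Q(1) by (simp add: assoc_mult_mat_vec[of _ d d _ d])
    have "Q ^\<^sub>m i *\<^sub>v (Q *\<^sub>v v) = 0\<^sub>v d" unfolding z[symmetric] by (rule Suc.prems(2))
    then have "Q *\<^sub>v v = 0\<^sub>v d" by (rule Suc.IH[rotated]) (simp add: v Q(1))
    then show ?case by (rule inj[OF v])
  qed
  have "\<rho> g * Q ^\<^sub>m q = Q ^\<^sub>m q * \<rho> g" if g: "g \<in> carrier G" for g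
    unfolding semi_pow[OF g] using char_pow[OF g]
    by (simp add: mult.commute[of j] power_mult) (auto simp: smult_mat_def)
  then obtain c where c: "Q ^\<^sub>m q = c \<cdot>\<^sub>m 1\<^sub>m d" using schur Q(1) by (metis pow_carrier_mat)
  have "c \<noteq> 0"
  proof
    assume "c = 0"
    then have "Q ^\<^sub>m q *\<^sub>v unit_vec d 0 = 0\<^sub>v d" unfolding c
      by (intro eq_vecI) (auto simp: scalar_prod_def)
    then have "unit_vec d 0 = (0\<^sub>v d :: complex vec)" by (rule inj_pow[rotated]) simp
    then have "unit_vec d 0 $ 0 = (0\<^sub>v d :: complex vec) $ 0" by simp
    then show False using dim_pos by simp
  qed
  \<comment> \<open>The inverse of a q-th root of c, in polar coordinates.\<close>
  define r where "r = rcis (root q (cmod (inverse c))) (Arg (inverse c) / of_nat q)"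
  have "r ^ q = inverse c"
    unfolding r_def DeMoivre2 using q_pos by (simp add: real_root_pow_pos2 rcis_cmod_Arg del: norm_inverse)
  then have r: "r ^ q * c = 1" using \<open>c \<noteq> 0\<close> by simp
  define R where "R i = r ^ i \<cdot>\<^sub>m (Q ^\<^sub>m i)" for i
  have Rc: "R i \<in> carrier_mat d d" for i using Q by (simp add: R_def)
  have R0: "R 0 = 1\<^sub>m d" using Q by (auto simp: R_def intro!: eq_matI)
  have Rq: "R q = 1\<^sub>m d" unfolding R_def c smult_mat_assoc r by (auto intro!: eq_matI)
  define T where "T = R 1"
  have Tc: "T \<in> carrier_mat d d" unfolding T_def by (rule Rc)
  have RR: "R i * T = R (Suc i)" for i
    using Q by (simp add: T_def R_def mult_smult_distrib[of _ d d _ d] mult_smult_assoc_mat[of _ d d _ d]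
      smult_mat_assoc mult.commute)
  have semiR: "\<rho> g * R i = (\<eta> g ^ j) ^ i \<cdot>\<^sub>m (R i * \<rho> g)" if g: "g \<in> carrier G" for g i
    using Q g semi_pow[OF g, of i]
    by (simp add: R_def mult_smult_distrib[of _ d d _ d] mult_smult_assoc_mat[of _ d d _ d]
      smult_mat_assoc mult.commute power_mult[symmetric])
  have semiT: "\<rho> g * T = \<eta> g ^ j \<cdot>\<^sub>m (T * \<rho> g)" if g: "g \<in> carrier G" for g
    using semiR[OF g, of 1] by (simp add: T_def)
  define E where "E = (1 / of_nat q) \<cdot>\<^sub>m mat_sum d R {..<q}"
  have E: "E \<in> carrier_mat d d" by (simp add: E_def)
  have ER: "E * T = E"
  proof -
    have "mat_sum d R {..<q} * T = mat_sum d (\<lambda>i. R (Suc i)) {..<q}"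
      using Rc by (simp add: mat_sum_mult_right Tc RR)
    also have "\<dots> = mat_sum d R {..<q}"
      unfolding mat_sum_def
      by (rule cong_mat) (auto intro!: sum_shift_periodic simp: R0 Rq)
    finally show ?thesis using Rc Tc by (simp add: E_def mult_smult_assoc_mat[of _ d d _ d])
  qed
  have ERi: "E * R i = E" for i
  proof (induction i)
    case 0 show ?case using E R0 by simp
  next
    case (Suc i)
    have "E * R (Suc i) = E * R i * T" unfolding RR[symmetric] using E Rc Tc
      by (simp add: assoc_mult_mat[of _ d d _ d _ d])
    then show ?case using Suc ER by simp
  qed
  have idem: "E * E = E"
  proof -
    have "E * E = (1 / of_nat q) \<cdot>\<^sub>m mat_sum d (\<lambda>i. E * R i) {..<q}"
      using E Rc by (subst (2) E_def) (simp add: mult_smult_distrib[of _ d d _ d] mat_sum_mult_left)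
    also have "\<dots> = E" unfolding ERi
      using E q_pos by (intro eq_matI) (auto simp: mat_sum_def)
    finally show ?thesis .
  qed
  have trE: "mat_trace E \<noteq> 0"
  proof -
    obtain g where g: "g \<in> carrier G" "\<eta> g \<noteq> 1" using char_nontrivial by blast
    have tr0: "mat_trace (R i) = 0" if i: "i \<in> {..<q} - {0}" for i
    proof -
      have "conj_by g (R i) = (\<eta> g ^ j) ^ i \<cdot>\<^sub>m R i"
      proof -
        have "conj_by g (R i) = (\<eta> g ^ j) ^ i \<cdot>\<^sub>m (R i * (\<rho> g * \<rho> (inv g)))"
          unfolding conj_by_def semiR[OF g(1)] using g Rc
          by (simp add: mult_smult_assoc_mat[of _ d d _ d] assoc_mult_mat[of _ d d _ d _ d])
        then show ?thesis using g right_mult_one_mat[OF Rc[of i]] by (simp add: rep_inv_right)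
      qed
      then have "mat_trace (R i) = (\<eta> g ^ j) ^ i * mat_trace (R i)"
        using trace_conj_by[OF g(1) Rc] mat_trace_smult[OF Rc] by metis
      moreover have "(\<eta> g ^ j) ^ i \<noteq> 1"
      proof
        assume "(\<eta> g ^ j) ^ i = 1"
        then have "(\<eta> g ^ i) ^ j = 1" by (simp add: power_mult[symmetric] mult.commute)
        moreover have "(\<eta> g ^ i) ^ q = 1"
          using char_pow[OF g(1)] by (simp add: power_mult[symmetric] mult.commute[of i] power_mult)
        ultimately have "\<eta> g ^ i = 1" using prime_root_of_unity_pow_eq_1[OF q_prime] j by blast
        then show False using char_pow_eq_1_iff[OF g(1)] g i by auto
      qed
      ultimately show ?thesis by simp
    qed
    have "mat_trace (mat_sum d R {..<q}) = (\<Sum>i<q. mat_trace (R i))"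
      using Rc by (intro mat_trace_mat_sum)
    also have "\<dots> = (\<Sum>i\<in>{0}. mat_trace (R i))"
      using q_pos tr0 by (intro sum.mono_neutral_right) auto
    also have "\<dots> = of_nat d" by (simp add: R0 mat_trace_def)
    finally show ?thesis using q_pos dim_pos
      unfolding E_def by (subst mat_trace_smult[of _ d]) auto
  qed
  have commN: "\<rho> g * E = E * \<rho> g" if g: "g \<in> char_kernel" for g
  proof -
    have gG: "g \<in> carrier G" "\<eta> g = 1" using g by (auto simp: char_kernel_def)
    have "\<rho> g * mat_sum d R {..<q} = mat_sum d (\<lambda>i. \<rho> g * R i) {..<q}"
      using gG Rc by (intro mat_sum_mult_left) auto
    also have "\<dots> = mat_sum d (\<lambda>i. R i * \<rho> g) {..<q}"
      using gG semiR[OF gG(1)] by (intro mat_sum_cong) (auto simp: smult_mat_def)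
    also have "\<dots> = mat_sum d R {..<q} * \<rho> g"
      using gG Rc by (intro mat_sum_mult_right[symmetric]) auto
    finally show ?thesis using gG
      by (simp add: E_def mult_smult_distrib[of _ d d _ d] mult_smult_assoc_mat[of _ d d _ d])
  qed
  have off: "E * (\<rho> g * E) = 0\<^sub>m d d" if g: "g \<in> carrier G" "g \<notin> char_kernel" for g
  proof -
    have R1: "T * R i = R i * T" for i
    proof (induction i)
      case 0 show ?case using Tc by (simp add: R0)
    next
      case (Suc i)
      have "T * R (Suc i) = T * R i * T" unfolding RR[symmetric] using Rc Tc
        by (simp add: assoc_mult_mat[of _ d d _ d _ d])
      then show ?case by (simp only: Suc RR)
    qed
    have "T * E = E * T"
      using Rc Tc by (simp add: E_def mult_smult_distrib[of _ d d _ d] mult_smult_assoc_mat[of _ d d _ d]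
        mat_sum_mult_left mat_sum_mult_right R1)
    then have RE: "T * E = E" by (simp add: ER)
    define M where "M = E * (\<rho> g * E)"
    have M: "M \<in> carrier_mat d d" using E g by (simp add: M_def)
    have "M = E * (\<rho> g * (T * E))" by (simp add: M_def RE)
    also have "\<dots> = E * ((\<rho> g * T) * E)" using E g Rc Tc by (simp add: assoc_mult_mat[of _ d d _ d _ d])
    also have "\<dots> = \<eta> g ^ j \<cdot>\<^sub>m ((E * T) * (\<rho> g * E))"
      unfolding semiT[OF g(1)] using E g Rc Tc
      by (simp add: mult_smult_distrib[of _ d d _ d] mult_smult_assoc_mat[of _ d d _ d]
        assoc_mult_mat[of _ d d _ d _ d])
    finally have eq: "M = \<eta> g ^ j \<cdot>\<^sub>m M" by (simp add: ER M_def)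
    have ne: "\<eta> g ^ j \<noteq> 1" using char_pow_eq_1_iff[OF g(1) j] g by (simp add: char_kernel_def)
    have "M = 0\<^sub>m d d"
    proof (rule eq_matI)
      fix a b assume ab: "a < dim_row (0\<^sub>m d d :: complex mat)" "b < dim_col (0\<^sub>m d d :: complex mat)"
      have "M $$ (a, b) = \<eta> g ^ j * M $$ (a, b)"
        using ab M by (subst eq) simp
      then show "M $$ (a, b) = 0\<^sub>m d d $$ (a, b)" using ne ab by simp
    qed (use M in auto)
    then show ?thesis by (simp add: M_def)
  qed
  show ?thesis using that[OF E idem trE commN off] by blast
qed

text \<open>
  An element outside the kernel moves every subspace of the imprimitivity system, so that its matrix
  has zero diagonal blocks. Formally, the identity is replaced by the normalized sum of the conjugates
  of \<open>E\<close>. By cyclicity of the trace, each summand then contributes the trace of \<open>E \<rho>(y) E\<close> for some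
  conjugate \<open>y\<close> of \<open>g\<close>.
\<close>

lemma trace_zero_off_char_kernel:
  assumes E: "E \<in> carrier_mat d d" "\<And>g. g \<in> carrier G \<Longrightarrow> g \<notin> char_kernel \<Longrightarrow> E * (\<rho> g * E) = 0\<^sub>m d d"
    and idem: "E * E = E"
    and tot: "mat_sum d (\<lambda>g. conj_by g E) (carrier G) = of_nat (card char_kernel) \<cdot>\<^sub>m 1\<^sub>m d"
    and g: "g \<in> carrier G" "g \<notin> char_kernel"
  shows "mat_trace (\<rho> g) = 0"
proof -
  have tr0: "mat_trace (\<rho> g * conj_by x E) = 0" if x: "x \<in> carrier G" for x
  proof -
    let ?y = "inv x \<otimes> (g \<otimes> x)"
    have y: "?y \<in> carrier G" using g x by simp
    have "\<eta> ?y = \<eta> g" using g x char_nonzero[OF x] by (simp add: char_mult char_inv)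
    then have yN: "?y \<notin> char_kernel" using g by (simp add: char_kernel_def)
    have "mat_trace (\<rho> g * conj_by x E) = mat_trace (\<rho> g * (\<rho> x * E) * \<rho> (inv x))"
      using g x E by (simp add: conj_by_def assoc_mult_mat[of _ d d _ d _ d])
    also have "\<dots> = mat_trace (\<rho> (inv x) * (\<rho> g * (\<rho> x * E)))"
      using g x E by (intro mat_trace_comm[of _ d d]) auto
    also have "\<rho> (inv x) * (\<rho> g * (\<rho> x * E)) = \<rho> ?y * E * E"
      using g x E idem by (simp add: rep_mult assoc_mult_mat[of _ d d _ d _ d])
    also have "mat_trace (\<rho> ?y * E * E) = mat_trace (E * (\<rho> ?y * E))"
      using E y by (intro mat_trace_comm[of _ d d]) auto
    also have "\<dots> = 0" using E(2)[OF y yN] by (simp add: mat_trace_def)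
    finally show ?thesis .
  qed
  have "of_nat (card char_kernel) \<cdot>\<^sub>m \<rho> g = \<rho> g * mat_sum d (\<lambda>x. conj_by x E) (carrier G)"
    unfolding tot using rep_carrier[OF g(1)] by (simp add: mult_smult_distrib[of _ d d _ d])
  also have "\<dots> = mat_sum d (\<lambda>x. \<rho> g * conj_by x E) (carrier G)"
    using g E by (intro mat_sum_mult_left) auto
  finally have "of_nat (card char_kernel) * mat_trace (\<rho> g) = mat_trace (mat_sum d (\<lambda>x. \<rho> g * conj_by x E) (carrier G))"
    using mat_trace_smult rep_carrier g(1) by metis
  also have "\<dots> = (\<Sum>x\<in>carrier G. mat_trace (\<rho> g * conj_by x E))"
    using g E by (intro mat_trace_mat_sum) auto
  also have "\<dots> = 0" using tr0 by simp
  finally show ?thesis using card_char_kernel_pos by simp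
qed

text \<open>
  In terms of the imprimitivity system, each of the \<open>q\<close> conjugate subspaces is counted once for every
  element of a coset. By Schur's lemma the sum is a scalar, and its value is found by multiplying by
  \<open>E\<close> and taking traces: only the conjugates by elements of the kernel contribute.
\<close>

lemma conj_idempotent_total:
  assumes E: "E \<in> carrier_mat d d" "E * E = E" "mat_trace E \<noteq> 0"
    and comm: "\<And>g. g \<in> char_kernel \<Longrightarrow> \<rho> g * E = E * \<rho> g"
    and off: "\<And>g. g \<in> carrier G \<Longrightarrow> g \<notin> char_kernel \<Longrightarrow> E * (\<rho> g * E) = 0\<^sub>m d d"
  shows "mat_sum d (\<lambda>g. conj_by g E) (carrier G) = of_nat (card char_kernel) \<cdot>\<^sub>m 1\<^sub>m d"
proof -
  \<comment> \<open>The weight 1 gives the sum the form of a twisted average.\<close>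
  define D where "D = mat_sum d (\<lambda>g. 1 \<cdot>\<^sub>m conj_by g E) (carrier G)"
  have one_smult: "1 \<cdot>\<^sub>m A = A" for A :: "complex mat" by (auto simp: smult_mat_def)
  have D: "D = mat_sum d (\<lambda>g. conj_by g E) (carrier G)" by (simp add: D_def one_smult)
  have Dc: "D \<in> carrier_mat d d" by (simp add: D_def)
  have "\<rho> h * D = D * \<rho> h" if "h \<in> carrier G" for h
    using twisted_average_semi_invariant[OF E(1) that, of "\<lambda>_. 1" 1] by (simp add: D_def one_smult)
  then obtain k where k: "D = k \<cdot>\<^sub>m 1\<^sub>m d" using schur[OF Dc] by blast
  have trm: "mat_trace (E * conj_by g E) = (if g \<in> char_kernel then mat_trace E else 0)" if g: "g \<in> carrier G" for g
  proof (cases "g \<in> char_kernel")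
    case True
    then have "conj_by g E = E * (\<rho> g * \<rho> (inv g))"
      unfolding conj_by_def comm[OF True] using g E by (simp add: assoc_mult_mat[of _ d d _ d _ d])
    then show ?thesis using True E g by (simp add: rep_inv_right)
  next
    case False
    have "E * conj_by g E = E * (\<rho> g * E) * \<rho> (inv g)"
      using g E by (simp add: conj_by_def assoc_mult_mat[of _ d d _ d _ d])
    also have "\<dots> = 0\<^sub>m d d" unfolding off[OF g False] using g by (intro left_mult_zero_mat) auto
    finally show ?thesis using False by (simp add: mat_trace_def)
  qed
  have "k * mat_trace E = mat_trace (E * D)"
    unfolding k using E mat_trace_smult[OF E(1)] by (simp add: mult_smult_distrib[of _ d d _ d])
  also have "\<dots> = mat_trace (mat_sum d (\<lambda>g. E * conj_by g E) (carrier G))"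
    unfolding D using E by (subst mat_sum_mult_left) auto
  also have "\<dots> = (\<Sum>g\<in>carrier G. mat_trace (E * conj_by g E))"
    using E by (intro mat_trace_mat_sum) auto
  also have "\<dots> = (\<Sum>g\<in>carrier G. if g \<in> char_kernel then mat_trace E else 0)"
    by (intro sum.cong trm refl)
  also have "\<dots> = of_nat (card char_kernel) * mat_trace E"
    using finite_group by (simp add: sum.If_cases char_kernel_def Int_def)
  finally have "k = of_nat (card char_kernel)" using E(3) by simp
  then show ?thesis using k D by simp
qed

text \<open>
  With \<open>E = B C\<close> and \<open>C B = 1\<close>, the representation of the kernel on the image of \<open>E\<close> is
  \<open>\<tau> g = C \<rho>(g) B\<close>; the same formula gives \<open>0\<close> outside the kernel. For an invariant subspace
  \<open>W\<close> of \<open>\<tau>\<close>, the vectors \<open>v\<close> with \<open>C \<rho>(g) v\<close> in \<open>W\<close> for all \<open>g\<close> form an invariant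
  subspace \<open>S\<close> of \<open>\<rho>\<close> which contains the image of \<open>W\<close> under \<open>B\<close>. So \<open>W = 0\<close> if
  \<open>S = 0\<close>, and \<open>W\<close> is everything if \<open>S\<close> is.

  In the formula for the induced character, the summand for \<open>x\<close> is the trace of \<open>\<rho>(g)\<close> times the
  conjugate of \<open>E\<close> by \<open>x\<close>, and these conjugates add up to a multiple of the identity.
\<close>

lemma induced_from_char_kernel:
  assumes H: "carrier H = char_kernel" "monoid.mult H = monoid.mult G"
    and E: "E \<in> carrier_mat d d" "E * E = E" "mat_trace E \<noteq> 0"
    and comm: "\<And>g. g \<in> char_kernel \<Longrightarrow> \<rho> g * E = E * \<rho> g"
    and off: "\<And>g. g \<in> carrier G \<Longrightarrow> g \<notin> char_kernel \<Longrightarrow> E * (\<rho> g * E) = 0\<^sub>m d d"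
  shows "\<exists>\<theta> \<in> Irr H. (\<lambda>g\<in>carrier G. mat_trace (\<rho> g)) = Ind G H \<theta>"
proof -
  have total: "mat_sum d (\<lambda>g. conj_by g E) (carrier G) = of_nat (card char_kernel) \<cdot>\<^sub>m 1\<^sub>m d"
    by (rule conj_idempotent_total[OF E]) (fact comm off)+
  obtain e B C where B: "B \<in> carrier_mat d e" and C: "C \<in> carrier_mat e d" and BC: "B * C = E"
    and CB: "C * B = 1\<^sub>m e"
    using idempotent_factorization[OF E(1,2)] by metis
  have e: "e > 0"
  proof (rule ccontr)
    assume "\<not> ?thesis"
    then have "C * B = 0\<^sub>m e e" "e = 0" using C B by (auto intro!: eq_matI)
    have "mat_trace E = mat_trace (C * B)" unfolding BC[symmetric] by (rule mat_trace_comm[OF B C])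
    also have "\<dots> = 0" unfolding CB using \<open>e = 0\<close> by (simp add: mat_trace_def)
    finally show False using E by simp
  qed
  have EB: "E * B = B"
  proof -
    have "E * B = B * (C * B)" unfolding BC[symmetric] using B C by (intro assoc_mult_mat) auto
    then show ?thesis unfolding CB using B by simp
  qed
  have CE: "C * E = C"
  proof -
    have "C * E = (C * B) * C" unfolding BC[symmetric] using B C by (intro assoc_mult_mat[symmetric]) auto
    then show ?thesis unfolding CB using C by simp
  qed
  define \<tau> where "\<tau> g = C * (\<rho> g * B)" for g
  have rB: "\<rho> g * B \<in> carrier_mat d e" if "g \<in> carrier G" for g using rep_carrier[OF that] B by auto
  have \<tau>c: "\<tau> g \<in> carrier_mat e e" if "g \<in> carrier G" for g
    unfolding \<tau>_def by (rule mult_carrier_mat[OF C rB[OF that]])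
  have NG: "g \<in> carrier G" if "g \<in> char_kernel" for g using that by (simp add: char_kernel_def)
  have \<tau>_mult: "\<tau> (m \<otimes> n) = \<tau> m * \<tau> n" if m: "m \<in> char_kernel" and n: "n \<in> carrier G" for m n
  proof -
    have mG: "m \<in> carrier G" using NG m by simp
    have "\<tau> m * \<tau> n = C * (\<rho> m * B * \<tau> n)"
      unfolding \<tau>_def[of m] using C rB[OF mG] \<tau>c[OF n] by (intro assoc_mult_mat) auto
    also have "\<rho> m * B * \<tau> n = \<rho> m * (B * \<tau> n)"
      using B rep_carrier[OF mG] \<tau>c[OF n] by (intro assoc_mult_mat) auto
    also have "B * \<tau> n = E * (\<rho> n * B)"
      unfolding \<tau>_def BC[symmetric] using B C rB[OF n] by (intro assoc_mult_mat[symmetric]) auto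
    also have "\<rho> m * (E * (\<rho> n * B)) = \<rho> m * E * (\<rho> n * B)"
      using E rep_carrier[OF mG] rB[OF n] by (intro assoc_mult_mat[symmetric]) auto
    also have "\<dots> = E * (\<rho> m * (\<rho> n * B))"
      unfolding comm[OF m] using E rep_carrier[OF mG] rB[OF n] by (intro assoc_mult_mat) auto
    also have "C * \<dots> = C * (\<rho> m * (\<rho> n * B))"
    proof -
      have "\<rho> m * (\<rho> n * B) \<in> carrier_mat d e" using rep_carrier[OF mG] rB[OF n] by auto
      then have "C * (E * (\<rho> m * (\<rho> n * B))) = C * E * (\<rho> m * (\<rho> n * B))"
        using C E by (intro assoc_mult_mat[symmetric]) auto
      then show ?thesis by (simp add: CE)
    qed
    also have "\<rho> m * (\<rho> n * B) = \<rho> (m \<otimes> n) * B"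
      unfolding rep_mult[OF mG n] using rep_carrier[OF mG] rep_carrier[OF n] B
      by (intro assoc_mult_mat[symmetric]) auto
    finally show ?thesis by (simp add: \<tau>_def)
  qed
  have \<tau>_one: "\<tau> \<one> = 1\<^sub>m e" using B CB by (simp add: \<tau>_def rep_one)
  have inv_N: "inv g \<in> char_kernel" if "g \<in> char_kernel" for g using that by (auto simp: char_kernel_def char_inv)
  have \<tau>_hom: "\<tau> \<in> hom H (GL e)"
  proof (rule homI)
    fix g assume "g \<in> carrier H"
    then have g: "g \<in> char_kernel" "g \<in> carrier G" using H NG by auto
    have "\<tau> g * \<tau> (inv g) = 1\<^sub>m e" "\<tau> (inv g) * \<tau> g = 1\<^sub>m e"
      using \<tau>_mult[OF g(1), of "inv g"] \<tau>_mult[OF inv_N[OF g(1)], of g] g \<tau>_one by auto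
    then show "\<tau> g \<in> carrier (GL e)"
      using \<tau>c[OF g(2)] \<tau>c[of "inv g"] g(2)
      by (auto simp: GL_def units_of_carrier Units_def ring_mat_def)
  next
    fix g h assume "g \<in> carrier H" "h \<in> carrier H"
    then show "\<tau> (g \<otimes>\<^bsub>H\<^esub> h) = \<tau> g \<otimes>\<^bsub>GL e\<^esub> \<tau> h"
      using H \<tau>_mult NG by (simp add: GL_def units_of_mult ring_mat_def)
  qed
  have \<tau>_irr: "W = {0\<^sub>v e} \<or> W = carrier_vec e"
    if W: "subspace class_ring W (module_vec TYPE(complex) e)"
      and inv: "\<forall>g\<in>carrier H. \<forall>w\<in>W. \<tau> g *\<^sub>v w \<in> W" for W
  proof (rule disjCI)
    assume "W \<noteq> carrier_vec e"
    define S where "S = {v \<in> carrier_vec d. \<forall>g\<in>carrier G. C *\<^sub>v (\<rho> g *\<^sub>v v) \<in> W}"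
    have Wp: "W \<subseteq> carrier_vec e" "0\<^sub>v e \<in> W" "\<And>v w. v \<in> W \<Longrightarrow> w \<in> W \<Longrightarrow> v + w \<in> W"
      "\<And>c v. v \<in> W \<Longrightarrow> c \<cdot>\<^sub>v v \<in> W"
      using W by (auto simp: subspace_vec_iff)
    have S_sub: "subspace class_ring S (module_vec TYPE(complex) d)"
      unfolding subspace_vec_iff
    proof (intro conjI ballI allI)
      have "C *\<^sub>v (\<rho> g *\<^sub>v 0\<^sub>v d) = 0\<^sub>v e" if "g \<in> carrier G" for g
        using rep_carrier[OF that] C by (intro eq_vecI) (auto simp: scalar_prod_def)
      then show "0\<^sub>v d \<in> S" using Wp by (simp add: S_def)
    next
      fix v w assume vw: "v \<in> S" "w \<in> S"
      then show "v + w \<in> S" using C Wp(3)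
        by (auto simp: S_def mult_add_distrib_mat_vec[of _ d d] mult_add_distrib_mat_vec[of _ e d])
    next
      fix c v assume "v \<in> S"
      then show "c \<cdot>\<^sub>v v \<in> S" using C Wp(4)
        by (auto simp: S_def mult_mat_vec[of _ d d] mult_mat_vec[of _ e d])
    qed (auto simp: S_def)
    have S_inv: "\<rho> g *\<^sub>v v \<in> S" if g: "g \<in> carrier G" and v: "v \<in> S" for g v
    proof -
      have "C *\<^sub>v (\<rho> h *\<^sub>v (\<rho> g *\<^sub>v v)) \<in> W" if h: "h \<in> carrier G" for h
      proof -
        have "\<rho> h *\<^sub>v (\<rho> g *\<^sub>v v) = \<rho> (h \<otimes> g) *\<^sub>v v"
          using g h v by (simp add: rep_mult S_def assoc_mult_mat_vec[of _ d d _ d])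
        then show ?thesis using v g h by (simp add: S_def)
      qed
      then show ?thesis using g v by (simp add: S_def)
    qed
    have "S \<noteq> carrier_vec d"
    proof
      assume S: "S = carrier_vec d"
      have "u \<in> W" if u: "u \<in> carrier_vec e" for u
      proof -
        have Bu: "B *\<^sub>v u \<in> carrier_vec d" using B u by auto
        then have "C *\<^sub>v (\<rho> \<one> *\<^sub>v (B *\<^sub>v u)) \<in> W" using S by (auto simp: S_def)
        moreover have "C *\<^sub>v (B *\<^sub>v u) = u"
          using assoc_mult_mat_vec[OF C B u] CB u by simp
        ultimately show ?thesis using Bu by (simp add: rep_one)
      qed
      then show False using Wp(1) \<open>W \<noteq> carrier_vec e\<close> by blast
    qed
    then have S0: "S = {0\<^sub>v d}" using irreducible[OF S_sub] S_inv by blast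
    have "w = 0\<^sub>v e" if w: "w \<in> W" for w
    proof -
      have wc: "w \<in> carrier_vec e" using w Wp by blast
      have Bw: "B *\<^sub>v w \<in> carrier_vec d" using B wc by auto
      have "C *\<^sub>v (\<rho> g *\<^sub>v (B *\<^sub>v w)) \<in> W" if g: "g \<in> carrier G" for g
      proof -
        have eq: "C *\<^sub>v (\<rho> g *\<^sub>v (B *\<^sub>v w)) = \<tau> g *\<^sub>v w"
          unfolding \<tau>_def assoc_mult_mat_vec[OF C rB[OF g] wc] assoc_mult_mat_vec[OF rep_carrier[OF g] B wc] ..
        show ?thesis
        proof (cases "g \<in> char_kernel")
          case True then show ?thesis using eq inv w H by simp
        next
          case False
          have "\<tau> g = C * (E * (\<rho> g * E)) * B"
          proof -
            have "C * (E * (\<rho> g * E)) = C * (\<rho> g * E)"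
              using C E g CE assoc_mult_mat[of C e d E d "\<rho> g * E" d] by simp
            moreover have "C * (\<rho> g * E) * B = C * (\<rho> g * E * B)"
              using C E g B by (intro assoc_mult_mat) auto
            moreover have "\<rho> g * E * B = \<rho> g * (E * B)"
              using E g B rep_carrier[OF g] by (intro assoc_mult_mat) auto
            ultimately show ?thesis by (simp add: EB \<tau>_def)
          qed
          also have "\<dots> = 0\<^sub>m e e" unfolding off[OF g False] using B C by simp
          finally have "\<tau> g *\<^sub>v w = 0\<^sub>v e" using wc by (intro eq_vecI) (auto simp: scalar_prod_def)
          then show ?thesis using eq Wp by simp
        qed
      qed
      then have "B *\<^sub>v w \<in> S" using Bw by (simp add: S_def)
      then have "B *\<^sub>v w = 0\<^sub>v d" using S0 by blast
      then have "C *\<^sub>v (B *\<^sub>v w) = 0\<^sub>v e" using C by (intro eq_vecI) (auto simp: scalar_prod_def)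
      then show ?thesis using assoc_mult_mat_vec[OF C B wc] CB wc by simp
    qed
    then show "W = {0\<^sub>v e}" using Wp by blast
  qed
  have irr: "irreducible_representation H e \<tau>"
    unfolding irreducible_representation_def using e \<tau>_hom \<tau>_irr by blast
  define \<theta> where "\<theta> = (\<lambda>g\<in>carrier H. mat_trace (\<tau> g))"
  have \<theta>: "\<theta> \<in> Irr H" unfolding Irr_def \<theta>_def using irr by blast
  have "mat_trace (\<rho> g) = Ind G H \<theta> g" if g: "g \<in> carrier G" for g
  proof -
    have conjN: "inv x \<otimes> g \<otimes> x \<in> char_kernel \<longleftrightarrow> g \<in> char_kernel" if x: "x \<in> carrier G" for x
    proof -
      have "\<eta> (inv x \<otimes> g \<otimes> x) = inverse (\<eta> x) * \<eta> g * \<eta> x"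
        using g x by (simp add: char_mult char_inv)
      also have "\<dots> = \<eta> g" using char_nonzero[OF x] by simp
      finally show ?thesis using g x by (simp add: char_kernel_def)
    qed
    show ?thesis
    proof (cases "g \<in> char_kernel")
      case False
      then have "Ind G H \<theta> g = 0" using g conjN H by (simp add: Ind_def)
      then show ?thesis using trace_zero_off_char_kernel[OF E(1) off E(2) total g False] by simp
    next
      case True
      have trm: "mat_trace (\<tau> (inv x \<otimes> g \<otimes> x)) = mat_trace (\<rho> g * conj_by x E)"
        if x: "x \<in> carrier G" for x
      proof -
        let ?y = "inv x \<otimes> g \<otimes> x"
        have y: "?y \<in> carrier G" using g x by simp
        have "mat_trace (\<tau> ?y) = mat_trace (\<rho> ?y * B * C)"
          unfolding \<tau>_def using C rB[OF y] by (rule mat_trace_comm)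
        also have "\<rho> ?y * B * C = \<rho> ?y * E"
          unfolding BC[symmetric] using B C rep_carrier[OF y] by (intro assoc_mult_mat) auto
        also have "\<dots> = \<rho> (inv x) * (\<rho> g * (\<rho> x * E))"
          using g x E by (simp add: rep_mult assoc_mult_mat[of _ d d _ d _ d])
        also have "mat_trace \<dots> = mat_trace (\<rho> g * (\<rho> x * E) * \<rho> (inv x))"
          using g x E by (intro mat_trace_comm[of _ d d]) auto
        also have "\<rho> g * (\<rho> x * E) * \<rho> (inv x) = \<rho> g * conj_by x E"
          using g x E by (simp add: conj_by_def assoc_mult_mat[of _ d d _ d _ d])
        finally show ?thesis .
      qed
      have "Ind G H \<theta> g = (\<Sum>x\<in>carrier G. mat_trace (\<tau> (inv x \<otimes> g \<otimes> x))) / of_nat (card char_kernel)"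
        using g True conjN H by (simp add: Ind_def \<theta>_def Coset.order_def)
      also have "(\<Sum>x\<in>carrier G. mat_trace (\<tau> (inv x \<otimes> g \<otimes> x)))
          = (\<Sum>x\<in>carrier G. mat_trace (\<rho> g * conj_by x E))"
        by (intro sum.cong refl trm)
      also have "\<dots> = mat_trace (mat_sum d (\<lambda>x. \<rho> g * conj_by x E) (carrier G))"
        using g E by (intro mat_trace_mat_sum[symmetric]) auto
      also have "mat_sum d (\<lambda>x. \<rho> g * conj_by x E) (carrier G)
          = \<rho> g * mat_sum d (\<lambda>x. conj_by x E) (carrier G)"
        using g E by (intro mat_sum_mult_left[symmetric]) auto
      also have "\<dots> = of_nat (card char_kernel) \<cdot>\<^sub>m \<rho> g"
        unfolding total using rep_carrier[OF g] by (simp add: mult_smult_distrib[of _ d d _ d])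
      also have "mat_trace \<dots> / of_nat (card char_kernel) = mat_trace (\<rho> g)"
        using mat_trace_smult[OF rep_carrier[OF g]] card_char_kernel_pos by simp
      finally show ?thesis by simp
    qed
  qed
  then have "(\<lambda>g\<in>carrier G. mat_trace (\<rho> g)) = Ind G H \<theta>"
    by (intro ext) (auto simp: restrict_def Ind_def)
  with \<theta> show ?thesis by blast
qed

text \<open>
  Clifford's theorem for a normal subgroup with cyclic quotient of prime order.
\<close>

theorem restriction_irreducible_or_induced:
  assumes H: "carrier H = char_kernel" "monoid.mult H = monoid.mult G"
  defines "\<chi> \<equiv> (\<lambda>g\<in>carrier G. mat_trace (\<rho> g))"
  shows "Res H \<chi> \<in> Irr H \<or> (\<exists>\<theta> \<in> Irr H. \<chi> = Ind G H \<theta>)"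
proof (cases "irreducible_representation H d \<rho>")
  case True
  have "Res H \<chi> = (\<lambda>g\<in>carrier H. mat_trace (\<rho> g))"
    by (rule ext) (auto simp: Res_def \<chi>_def H char_kernel_def restrict_def)
  then show ?thesis using True unfolding Irr_def by blast
next
  case False
  have "\<rho> \<in> hom H (GL d)"
    using hom_GL H by (auto simp: hom_def char_kernel_def)
  then obtain W where W: "subspace class_ring W (module_vec TYPE(complex) d)"
    "\<forall>g\<in>char_kernel. \<forall>w\<in>W. \<rho> g *\<^sub>v w \<in> W" "W \<noteq> {0\<^sub>v d}" "W \<noteq> carrier_vec d"
    using False dim_pos H unfolding irreducible_representation_def by auto
  obtain j Q where Q: "0 < j" "j < q" "Q \<in> carrier_mat d d" "Q \<noteq> 0\<^sub>m d d"
    "\<And>g. g \<in> carrier G \<Longrightarrow> \<rho> g * Q = \<eta> g ^ j \<cdot>\<^sub>m (Q * \<rho> g)"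
    using semi_invariant_exists[OF W(1,3,4)] W(2) by blast
  obtain E where "E \<in> carrier_mat d d" "E * E = E" "mat_trace E \<noteq> 0"
    "\<And>g. g \<in> char_kernel \<Longrightarrow> \<rho> g * E = E * \<rho> g"
    "\<And>g. g \<in> carrier G \<Longrightarrow> g \<notin> char_kernel \<Longrightarrow> E * (\<rho> g * E) = 0\<^sub>m d d"
    using imprimitivity_idempotent[OF Q] by blast
  then show ?thesis using induced_from_char_kernel[OF H] unfolding \<chi>_def by blast
qed

end

section \<open>Finite extensions and minimal polynomials\<close>

abbreviation CC :: "complex ring" where "CC \<equiv> class_ring"

lemma CC_field: "Ring.field CC" by (rule class_field)
lemma CC_domain: "Ring.domain CC" using CC_field by (rule field.axioms)
lemma CC_ring: "Ring.ring CC" using CC_domain by (simp add: domain_def cring_def)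

lemma subfield_closed:
  assumes "subfield L CC"
  shows "0 \<in> L" "1 \<in> L" "\<And>x. x \<in> L \<Longrightarrow> - x \<in> L"
    "\<And>x y. x \<in> L \<Longrightarrow> y \<in> L \<Longrightarrow> x * y \<in> L" "\<And>x y. x \<in> L \<Longrightarrow> y \<in> L \<Longrightarrow> x + y \<in> L"
  using subringE[OF subfieldE(1)[OF assms]] by (auto simp: class_ring_simps)

text \<open>
  The inverse of the ring structure is only specified for units, while the inverse of the type class
  is zero at zero; they agree elsewhere.
\<close>

lemma subfield_inverse:
  assumes "subfield L CC" "x \<in> L" shows "inverse x \<in> L"
proof (cases "x = 0")
  case False
  then have "inv\<^bsub>CC\<^esub> x \<in> L" using ring.subfield_m_inv(1)[OF CC_ring assms(1), of x] assms(2) by auto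
  moreover have "inv\<^bsub>CC\<^esub> x = inverse x"
  proof -
    have "x * inv\<^bsub>CC\<^esub> x = 1"
      using ring.subfield_m_inv(2)[OF CC_ring assms(1), of x] assms(2) False by auto
    then show ?thesis by (metis inverse_unique)
  qed
  ultimately show ?thesis by simp
qed (use assms in auto)

lemma subfieldI_closed:
  assumes "0 \<in> L" "1 \<in> L" "\<And>x. x \<in> L \<Longrightarrow> - x \<in> L"
    "\<And>x y. x \<in> L \<Longrightarrow> y \<in> L \<Longrightarrow> x * y \<in> L" "\<And>x y. x \<in> L \<Longrightarrow> y \<in> L \<Longrightarrow> x + y \<in> L"
    "\<And>x. x \<in> L \<Longrightarrow> x \<noteq> 0 \<Longrightarrow> inverse x \<in> L"
  shows "subfield L CC"
proof (rule field.subfieldI'[OF CC_field])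
  show "subring L CC"
    using assms by (intro ring.subringI[OF CC_ring]) (auto simp: class_ring_simps)
  fix x assume x: "x \<in> L - {\<zero>\<^bsub>CC\<^esub>}"
  have "inv\<^bsub>CC\<^esub> x = inverse x"
  proof -
    have "x \<in> Units CC" using x field.field_Units[OF CC_field] by auto
    then have "x \<otimes>\<^bsub>CC\<^esub> inv\<^bsub>CC\<^esub> x = \<one>\<^bsub>CC\<^esub>"
      using monoid.Units_r_inv[OF ring.is_monoid[OF CC_ring]] by blast
    then show ?thesis by (simp add: inverse_unique)
  qed
  then show "inv\<^bsub>CC\<^esub> x \<in> L" using assms(6) x by auto
qed

lemma finite_extension_trans:
  assumes "finite_extension F E" "finite_extension E L" shows "finite_extension F L"
  using assms ring.telescopic_base_dim(1)[OF CC_ring] unfolding finite_extension_def by blast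

lemma subalgebra_subfield:
  assumes "subfield L CC" "F \<subseteq> L" shows "subalgebra F L CC"
proof (rule subalgebra.intro)
  show "subgroup L (add_monoid CC)" using subfieldE(1)[OF assms(1)] by (rule subring.axioms)
  show "subalgebra_axioms F L CC"
    unfolding subalgebra_axioms_def using assms subfield_closed(4)[OF assms(1)] by auto
qed

lemma finite_extension_base:
  assumes "finite_extension F L"
  obtains Us where "set Us \<subseteq> L" "ring.Span CC F Us = L"
proof -
  have F: "subfield F CC" and fd: "ring.finite_dimension CC F L"
    using assms by (auto simp: finite_extension_def)
  obtain Us where Us: "set Us \<subseteq> carrier CC" "ring.Span CC F Us = L"
    using ring.exists_base[OF CC_ring F ring.finite_dimensionE[OF CC_ring F fd]] by blast
  then have "set Us \<subseteq> L" using ring.Span_base_incl[OF CC_ring F Us(1)] by blast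
  with that Us show ?thesis by blast
qed

text \<open>
  An \<open>F\<close>-basis of \<open>L\<close> spans \<open>L\<close> over \<open>E\<close> as well.
\<close>

lemma intermediate_finite_extension:
  assumes FL: "finite_extension F L" and E: "subfield E CC" "F \<subseteq> E" "E \<subseteq> L"
  shows "finite_extension F E" "finite_extension E L"
proof -
  have F: "subfield F CC" and L: "subfield L CC" and fd: "ring.finite_dimension CC F L"
    using FL by (auto simp: finite_extension_def)
  show "finite_extension F E"
    using ring.subalbegra_incl_imp_finite_dimension[OF CC_ring F fd subalgebra_subfield[OF E(1,2)] E(3)] E F
    by (simp add: finite_extension_def)
  obtain Us where Us: "set Us \<subseteq> L" "ring.Span CC F Us = L" using finite_extension_base[OF FL] .
  have UC: "set Us \<subseteq> carrier CC" by simp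
  have "ring.Span CC E Us \<subseteq> L"
    using ring.subalgebra_Span_incl[OF CC_ring E(1) subalgebra_subfield[OF L E(3)] Us(1)] .
  moreover have "subalgebra F (ring.Span CC E Us) CC"
    using ring.Span_is_subalgebra[OF CC_ring E(1) UC] E(2)
    unfolding subalgebra_def subalgebra_axioms_def by blast
  then have "ring.Span CC F Us \<subseteq> ring.Span CC E Us"
    using ring.subalgebra_Span_incl[OF CC_ring F _ ring.Span_base_incl[OF CC_ring E(1) UC]] by blast
  ultimately have "ring.Span CC E Us = L" using Us by blast
  then have "ring.finite_dimension CC E L"
    using ring.Span_finite_dimension[OF CC_ring E(1) UC] by metis
  then show "finite_extension E L" using E L by (simp add: finite_extension_def)
qed

lemma degree_over_tower:
  assumes "finite_extension F E" "finite_extension E L"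
  shows "degree_over F L = degree_over F E * degree_over E L"
  using assms ring.telescopic_base_dim(2)[OF CC_ring]
  unfolding finite_extension_def degree_over_def over_def by blast

text \<open>
  A basis of \<open>F\<close> over itself consists of one element and is independent in \<open>L\<close>, so it spans \<open>L\<close>.
\<close>

lemma degree_over_eq_1:
  assumes FL: "finite_extension F L" and 1: "degree_over F L = 1"
  shows "F = L"
proof -
  have F: "subfield F CC" and sub: "F \<subseteq> L" and fd: "ring.finite_dimension CC F L"
    using FL by (auto simp: finite_extension_def)
  have L: "ring.dimension CC 1 F L"
    using ring.finite_dimensionE[OF CC_ring F fd] 1 by (simp add: degree_over_def over_def)
  obtain Us where Us: "ring.independent CC F Us" "length Us = 1" "ring.Span CC F Us = F"
    using ring.exists_base[OF CC_ring F ring.dimension_one[OF CC_ring F]] by blast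
  have "set Us \<subseteq> F" using ring.Span_base_incl[OF CC_ring F, of Us] Us by auto
  then show ?thesis
    using ring.independent_length_eq_dimension[OF CC_ring F L Us(1)] Us sub by blast
qed

lemma no_intermediate_field_of_prime_degree:
  assumes FL: "finite_extension F L" and q: "Factorial_Ring.prime (degree_over F L)"
    and E: "subfield E CC" "F \<subseteq> E" "E \<subseteq> L" and "E \<noteq> F"
  shows "E = L"
proof -
  note ext = intermediate_finite_extension[OF FL E]
  have "degree_over F E \<noteq> 1" using degree_over_eq_1[OF ext(1)] assms by blast
  then have "degree_over E L = 1"
    using q unfolding degree_over_tower[OF ext] by (metis prime_product)
  then show ?thesis using degree_over_eq_1[OF ext(2)] by blast
qed

lemma eval_eq_poly: "ring.eval CC p x = poly (Poly (rev p)) x"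
proof (induction p)
  case Nil
  show ?case by (simp add: ring.eval.simps[OF CC_ring])
next
  case (Cons a p)
  have "Poly (rev p @ [a]) = Poly (rev p) + monom a (length p)" by (simp add: Poly_append mult.commute smult_monom)
  then show ?case using Cons by (simp add: ring.eval.simps[OF CC_ring] poly_monom class_ring_simps)
qed

text \<open>
  The minimal polynomial over a subfield of a ring with a carrier is a list of coefficients, the leading
  one first. Here it becomes an element of the type of complex polynomials, where roots can be
  counted.
\<close>

lemma minimal_polynomial_exists:
  assumes FL: "finite_extension F L" and x: "x \<in> L"
  obtains p where "\<And>i. coeff p i \<in> F" "p \<noteq> 0" "poly p x = 0"
    "\<And>r. (\<And>i. coeff r i \<in> F) \<Longrightarrow> r \<noteq> 0 \<Longrightarrow> poly r x = 0 \<Longrightarrow> degree p \<le> degree r"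
    "degree p = degree_over F (ring.simple_extension CC F x)"
    "subfield (ring.simple_extension CC F x) CC"
proof -
  have F: "subfield F CC" and L: "subfield L CC" and fd: "ring.finite_dimension CC F L"
    using FL by (auto simp: finite_extension_def)
  have xC: "x \<in> carrier CC" by simp
  have alg: "(ring.algebraic CC over F) x"
    using ring.finite_dimension_imp_algebraic[OF CC_ring F subfieldE(1)[OF L] fd x] .
  let ?m = "ring.Irr CC F x"
  note m = domain.IrrE[OF CC_domain F xC alg]
  have "polynomial\<^bsub>CC\<^esub> F ?m" using m(1) by (simp add: univ_poly_carrier)
  have ne: "?m \<noteq> []"
    using m(2) by (auto simp: ring_irreducible_def univ_poly_zero)
  have set_m: "set ?m \<subseteq> F" and hd_m: "hd ?m \<noteq> 0"
    using \<open>polynomial\<^bsub>CC\<^esub> F ?m\<close> ne by (auto simp: polynomial_def)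
  define p where "p = Poly (rev ?m)"
  have co: "coeffs p = rev ?m"
    unfolding p_def coeffs_Poly strip_while_idem_iff no_trailing_unfold using hd_m by (simp add: last_rev)
  have deg: "degree p = length ?m - 1"
    by (simp add: degree_eq_length_coeffs co)
  have "coeff p i \<in> F" for i
    using set_m subfield_closed(1)[OF F] nth_mem[of i "rev ?m"]
    by (auto simp: p_def nth_default_def simp del: nth_mem)
  moreover have "p \<noteq> 0" using co ne by auto
  moreover have "poly p x = 0" using m(4) by (simp add: p_def eval_eq_poly)
  moreover have "degree p \<le> degree r" if r: "\<And>i. coeff r i \<in> F" "r \<noteq> 0" "poly r x = 0" for r
  proof -
    let ?r = "rev (coeffs r)"
    have "polynomial\<^bsub>CC\<^esub> F ?r" using r
      by (auto simp: polynomial_def hd_rev last_coeffs_eq_coeff_degree coeffs_def)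
    then have rc: "?r \<in> carrier (univ_poly CC F)" by (simp add: univ_poly_carrier)
    have "ring.eval CC ?r x = \<zero>\<^bsub>CC\<^esub>" using r(3) by (simp add: eval_eq_poly)
    then have "?m pdivides\<^bsub>CC\<^esub> ?r" using domain.Irr_minimal[OF CC_domain F xC alg rc] by blast
    then have "length ?m - 1 \<le> length ?r - 1"
      using domain.pdivides_imp_degree_le[OF CC_domain subfieldE(1)[OF F] m(1) rc] r by auto
    then show ?thesis using deg by (simp add: degree_eq_length_coeffs)
  qed
  moreover have "degree p = degree_over F (ring.simple_extension CC F x)"
    using domain.simple_extension_dim[OF CC_domain F xC alg] deg by (simp add: degree_over_def over_def)
  moreover have "subfield (ring.simple_extension CC F x) CC"
    using domain.simple_extension_is_subfield[OF CC_domain F xC] alg by blast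
  ultimately show ?thesis using that by blast
qed

text \<open>
  The map \<open>\<sigma>\<close> respects the operations on \<open>A\<close> only. The coefficients of the product all lie in
  \<open>A\<close>, so applying \<open>\<sigma>\<close> to them amounts to applying it to the roots.
\<close>

lemma coeff_linear_product:
  fixes f :: "'i \<Rightarrow> complex" and \<sigma> :: "complex \<Rightarrow> complex"
  assumes A: "subfield A CC" and fin: "finite S" and f: "\<And>s. s \<in> S \<Longrightarrow> f s \<in> A"
    and add: "\<And>x y. x \<in> A \<Longrightarrow> y \<in> A \<Longrightarrow> \<sigma> (x + y) = \<sigma> x + \<sigma> y"
    and mul: "\<And>x y. x \<in> A \<Longrightarrow> y \<in> A \<Longrightarrow> \<sigma> (x * y) = \<sigma> x * \<sigma> y"
    and one: "\<sigma> 1 = 1"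
  shows "coeff (\<Prod>s\<in>S. [:- f s, 1:]) i \<in> A \<and>
    \<sigma> (coeff (\<Prod>s\<in>S. [:- f s, 1:]) i) = coeff (\<Prod>s\<in>S. [:- \<sigma> (f s), 1:]) i"
  using fin f
proof (induction S arbitrary: i)
  case empty
  have "\<sigma> 0 = 0" using add[of 0 0] subfield_closed[OF A] by simp
  then show ?case using subfield_closed[OF A] one by (auto simp: one_pCons coeff_pCons split: nat.split)
next
  case (insert s S)
  have \<sigma>0: "\<sigma> 0 = 0" using add[of 0 0] subfield_closed[OF A] by simp
  have neg: "\<sigma> (- x) = - \<sigma> x" if "x \<in> A" for x
    using add[of x "- x"] that subfield_closed(3)[OF A that] \<sigma>0 by (simp add: eq_neg_iff_add_eq_0 add.commute)
  let ?p = "\<Prod>s\<in>S. [:- f s, 1:]" and ?p' = "\<Prod>s\<in>S. [:- \<sigma> (f s), 1:]"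
  have c: "coeff ([:- a, 1:] * p) i = - a * coeff p i + (case i of 0 \<Rightarrow> 0 | Suc j \<Rightarrow> coeff p j)"
    for a :: complex and p by (simp add: coeff_pCons)
  have IH: "coeff ?p j \<in> A" "\<sigma> (coeff ?p j) = coeff ?p' j" for j using insert by auto
  have fs: "f s \<in> A" using insert by simp
  let ?r = "case i of 0 \<Rightarrow> 0 | Suc j \<Rightarrow> coeff ?p j"
  have r: "?r \<in> A" "\<sigma> ?r = (case i of 0 \<Rightarrow> 0 | Suc j \<Rightarrow> coeff ?p' j)"
    using IH subfield_closed(1)[OF A] \<sigma>0 by (auto split: nat.split)
  have "coeff (\<Prod>s\<in>insert s S. [:- f s, 1:]) i = - f s * coeff ?p i + ?r"
    using insert(1,2) c by simp
  moreover have "coeff (\<Prod>s\<in>insert s S. [:- \<sigma> (f s), 1:]) i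
      = - \<sigma> (f s) * coeff ?p' i + (case i of 0 \<Rightarrow> 0 | Suc j \<Rightarrow> coeff ?p' j)"
    using insert(1,2) c by simp
  moreover have m: "- f s * coeff ?p i \<in> A"
    by (rule subfield_closed(4)[OF A subfield_closed(3)[OF A fs] IH(1)])
  then have "- f s * coeff ?p i + ?r \<in> A" by (rule subfield_closed(5)[OF A _ r(1)])
  moreover have "\<sigma> (- f s * coeff ?p i + ?r) = - \<sigma> (f s) * coeff ?p' i + \<sigma> ?r"
    unfolding add[OF m r(1)] mul[OF subfield_closed(3)[OF A fs] IH(1)] neg[OF fs] IH(2) ..
  ultimately show ?case by (simp only: r(2))
qed

section \<open>Galois groups\<close>

lemma Gal_carrier_iff:
  "\<sigma> \<in> carrier (Gal L F) \<longleftrightarrow> \<sigma> \<in> Bij L \<and> (\<forall>x\<in>L. \<forall>y\<in>L. \<sigma> (x * y) = \<sigma> x * \<sigma> y \<and> \<sigma> (x + y) = \<sigma> x + \<sigma> y)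
     \<and> \<sigma> 1 = 1 \<and> (\<forall>x\<in>F. \<sigma> x = x)"
  by (auto simp: Gal_def Ring.ring_hom_def Bij_imp_funcset dest: Bij_imp_funcset)

lemma Gal_mult: "\<sigma> \<in> carrier (Gal L F) \<Longrightarrow> \<tau> \<in> carrier (Gal L F) \<Longrightarrow> \<sigma> \<otimes>\<^bsub>Gal L F\<^esub> \<tau> = compose L \<sigma> \<tau>"
  by (simp add: Gal_carrier_iff) (simp add: Gal_def BijGroup_def)

lemma Gal_one: "\<one>\<^bsub>Gal L F\<^esub> = (\<lambda>x\<in>L. x)"
  by (simp add: Gal_def BijGroup_def)

lemma GalD:
  assumes "\<sigma> \<in> carrier (Gal L F)"
  shows "\<And>x. x \<in> L \<Longrightarrow> \<sigma> x \<in> L" "\<sigma> \<in> extensional L" "inj_on \<sigma> L" "\<sigma> ` L = L"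
    "\<And>x y. x \<in> L \<Longrightarrow> y \<in> L \<Longrightarrow> \<sigma> (x * y) = \<sigma> x * \<sigma> y"
    "\<And>x y. x \<in> L \<Longrightarrow> y \<in> L \<Longrightarrow> \<sigma> (x + y) = \<sigma> x + \<sigma> y"
    "\<sigma> 1 = 1" "\<And>x. x \<in> F \<Longrightarrow> \<sigma> x = x"
  using assms by (auto simp: Gal_carrier_iff Bij_def bij_betw_def)

lemma Gal_group:
  assumes L: "subfield L CC" and "F \<subseteq> L"
  shows "group (Gal L F)"
proof -
  have "subgroup (carrier (Gal L F)) (BijGroup L)"
  proof (rule group.subgroupI[OF group_BijGroup])
    show "carrier (Gal L F) \<subseteq> carrier (BijGroup L)"
      by (auto simp: Gal_carrier_iff BijGroup_def)
    have "(\<lambda>x\<in>L. x) \<in> carrier (Gal L F)"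
      using assms subfield_closed[OF L] by (auto simp: Gal_carrier_iff id_Bij)
    then show "carrier (Gal L F) \<noteq> {}" by blast
    fix \<sigma> assume s: "\<sigma> \<in> carrier (Gal L F)"
    then have B: "\<sigma> \<in> Bij L" by (simp add: Gal_carrier_iff)
    note \<sigma> = GalD[OF s]
    let ?i = "\<lambda>x\<in>L. inv_into L \<sigma> x"
    have i: "inv_into L \<sigma> x \<in> L" "\<sigma> (inv_into L \<sigma> x) = x" if "x \<in> L" for x
      using that \<sigma>(4) by (metis inv_into_into, metis f_inv_into_f)
    have eq: "inv_into L \<sigma> y = x" if "x \<in> L" "\<sigma> x = y" for x y
      using that \<sigma>(3) by (metis inv_into_f_f)
    have "?i \<in> carrier (Gal L F)"
      unfolding Gal_carrier_iff
    proof (intro conjI ballI)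
      show "?i \<in> Bij L" using B by (rule restrict_inv_into_Bij)
    qed (use assms subfield_closed[OF L] i \<sigma> in \<open>auto intro!: eq\<close>)
    then show "inv\<^bsub>BijGroup L\<^esub> \<sigma> \<in> carrier (Gal L F)" by (simp only: inv_BijGroup[OF B])
    fix \<tau> assume t: "\<tau> \<in> carrier (Gal L F)"
    then have "\<tau> \<in> Bij L" by (simp add: Gal_carrier_iff)
    moreover have "compose L \<sigma> \<tau> \<in> carrier (Gal L F)"
      unfolding Gal_carrier_iff
    proof (intro conjI)
      show "compose L \<sigma> \<tau> \<in> Bij L" using B \<open>\<tau> \<in> Bij L\<close> by (rule compose_Bij)
    qed (use \<sigma> GalD[OF t] assms subfield_closed[OF L] in \<open>auto simp: compose_def subset_iff\<close>)
    ultimately show "\<sigma> \<otimes>\<^bsub>BijGroup L\<^esub> \<tau> \<in> carrier (Gal L F)" using B by (simp add: BijGroup_def)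
  qed
  then have "group ((BijGroup L)\<lparr>carrier := carrier (Gal L F)\<rparr>)"
    using subgroup.subgroup_is_group group_BijGroup by blast
  then show ?thesis by (simp add: Gal_def)
qed

lemma poly_automorphism:
  assumes L: "subfield L CC" "F \<subseteq> L" and s: "\<sigma> \<in> carrier (Gal L F)"
    and p: "\<And>i. coeff p i \<in> F" and x: "x \<in> L"
  shows "poly p x \<in> L \<and> \<sigma> (poly p x) = poly p (\<sigma> x)"
  using p
proof (induction p)
  case 0
  have "\<sigma> 0 = 0" using GalD(6)[OF s, of 0 0] subfield_closed[OF L(1)] by simp
  then show ?case using subfield_closed[OF L(1)] by simp
next
  case (pCons a p)
  have a: "a \<in> F" using pCons(3)[of 0] by simp
  have "coeff p i \<in> F" for i using pCons(3)[of "Suc i"] by simp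
  then have IH: "poly p x \<in> L" "\<sigma> (poly p x) = poly p (\<sigma> x)" using pCons by auto
  moreover have "a \<in> L" using a L by blast
  ultimately show ?case using subfield_closed[OF L(1)] x a GalD[OF s] by simp
qed

lemma Gal_eqI:
  assumes FL: "finite_extension F L" and Us: "ring.Span CC F Us = L" "set Us \<subseteq> L"
    and s: "\<sigma> \<in> carrier (Gal L F)" and t: "\<tau> \<in> carrier (Gal L F)"
    and eq: "\<And>u. u \<in> set Us \<Longrightarrow> \<sigma> u = \<tau> u"
  shows "\<sigma> = \<tau>"
proof -
  have F: "subfield F CC" and L: "subfield L CC" and sub: "F \<subseteq> L"
    using FL by (auto simp: finite_extension_def)
  have agree: "ring.Span CC F Vs \<subseteq> {x \<in> L. \<sigma> x = \<tau> x}" if "set Vs \<subseteq> set Us" for Vs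
    using that
  proof (induction Vs)
    case Nil
    have "\<sigma> 0 = 0" "\<tau> 0 = 0" using GalD(6)[OF s, of 0 0] GalD(6)[OF t, of 0 0] subfield_closed[OF L] by simp_all
    then show ?case using subfield_closed[OF L] by (simp add: ring.Span.simps[OF CC_ring])
  next
    case (Cons v Vs)
    show ?case
    proof
      fix y assume "y \<in> ring.Span CC F (v # Vs)"
      then obtain a w where y: "a \<in> F" "w \<in> ring.Span CC F Vs" "y = a * v + w"
        by (auto simp: ring.Span.simps[OF CC_ring] ring.line_extension_mem_iff[OF CC_ring])
      have v: "v \<in> L" "\<sigma> v = \<tau> v" and w: "w \<in> L" "\<sigma> w = \<tau> w" and a: "a \<in> L"
        using Cons y Us eq sub by auto
      then show "y \<in> {x \<in> L. \<sigma> x = \<tau> x}"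
        using y GalD[OF s] GalD[OF t] subfield_closed[OF L] by simp
    qed
  qed
  have "\<sigma> x = \<tau> x" if "x \<in> L" for x using agree[of Us] Us that by blast
  then show ?thesis using GalD(2)[OF s] GalD(2)[OF t] by (rule_tac extensionalityI) auto
qed

text \<open>
  An automorphism is determined by its values on a finite spanning set, and each of these values is
  one of the finitely many roots of a polynomial.
\<close>

lemma Gal_finite:
  assumes FL: "finite_extension F L"
  shows "finite (carrier (Gal L F))"
proof -
  have F: "subfield F CC" and L: "subfield L CC" and sub: "F \<subseteq> L"
    using FL by (auto simp: finite_extension_def)
  obtain Us where Us: "set Us \<subseteq> L" "ring.Span CC F Us = L" using finite_extension_base[OF FL] .
  have "\<exists>p. (\<forall>i. coeff p i \<in> F) \<and> p \<noteq> 0 \<and> poly p u = 0" if "u \<in> L" for u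
    using minimal_polynomial_exists[OF FL that] by metis
  then obtain m where m: "\<And>u i. u \<in> L \<Longrightarrow> coeff (m u) i \<in> F" "\<And>u. u \<in> L \<Longrightarrow> m u \<noteq> 0"
    "\<And>u. u \<in> L \<Longrightarrow> poly (m u) u = 0" by metis
  let ?r = "\<lambda>\<sigma>. restrict \<sigma> (set Us)"
  have root: "poly (m u) (\<sigma> u) = 0" if s: "\<sigma> \<in> carrier (Gal L F)" and u: "u \<in> L" for \<sigma> u
  proof -
    have "\<sigma> 0 = 0" using GalD(6)[OF s, of 0 0] subfield_closed[OF L] by simp
    then show ?thesis using poly_automorphism[OF L sub s m(1)[OF u] u] m(3)[OF u] by simp
  qed
  have "?r ` carrier (Gal L F) \<subseteq> (\<Pi>\<^sub>E u\<in>set Us. {z. poly (m u) z = 0})"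
    using root Us by auto
  moreover have "finite (\<Pi>\<^sub>E u\<in>set Us. {z. poly (m u) z = 0})"
    using m(2) Us(1) poly_roots_finite by (intro finite_PiE) blast+
  ultimately have "finite (?r ` carrier (Gal L F))" by (rule finite_subset)
  moreover have "inj_on ?r (carrier (Gal L F))"
  proof (rule inj_onI)
    fix \<sigma> \<tau> assume st: "\<sigma> \<in> carrier (Gal L F)" "\<tau> \<in> carrier (Gal L F)" "?r \<sigma> = ?r \<tau>"
    have "\<sigma> u = \<tau> u" if "u \<in> set Us" for u using st(3) that by (metis restrict_apply')
    then show "\<sigma> = \<tau>" using Gal_eqI[OF FL Us(2,1) st(1,2)] by blast
  qed
  ultimately show ?thesis by (rule finite_imageD)
qed

text \<open>
  Composition with an automorphism permutes the factors of \<open>f\<close>, so its coefficients are fixed by the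
  Galois group, and hence they lie in \<open>F\<close>.
\<close>

lemma orbit_polynomial:
  assumes gal: "finite_galois_extension F L" and x: "x \<in> L"
  defines "f \<equiv> \<Prod>\<tau>\<in>carrier (Gal L F). [:- \<tau> x, 1:]"
  shows "\<And>i. coeff f i \<in> F" "\<And>z. poly f z = 0 \<longleftrightarrow> (\<exists>\<tau>\<in>carrier (Gal L F). z = \<tau> x)" "poly f x = 0"
    "degree f = card (carrier (Gal L F))" "f \<noteq> 0"
proof -
  have FL: "finite_extension F L" and fix_eq: "{x \<in> L. \<forall>\<sigma>\<in>carrier (Gal L F). \<sigma> x = x} = F"
    using gal by (auto simp: finite_galois_extension_def)
  have F: "subfield F CC" and L: "subfield L CC" and sub: "F \<subseteq> L"
    using FL by (auto simp: finite_extension_def)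
  interpret G: group "Gal L F" using Gal_group[OF L sub] .
  note fin = Gal_finite[OF FL]
  show "coeff f i \<in> F" for i
  proof -
    have *: "coeff f i \<in> L \<and> \<sigma> (coeff f i) = coeff f i" if s: "\<sigma> \<in> carrier (Gal L F)" for \<sigma>
    proof -
      have "coeff f i \<in> L \<and> \<sigma> (coeff f i) = coeff (\<Prod>\<tau>\<in>carrier (Gal L F). [:- \<sigma> (\<tau> x), 1:]) i"
        unfolding f_def using GalD[OF s] x
        by (intro coeff_linear_product[OF L fin]) (auto dest: GalD(1))
      also have "(\<Prod>\<tau>\<in>carrier (Gal L F). [:- \<sigma> (\<tau> x), 1:])
          = (\<Prod>\<tau>\<in>carrier (Gal L F). [:- (\<sigma> \<otimes>\<^bsub>Gal L F\<^esub> \<tau>) x, 1:])"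
        using x s by (intro prod.cong) (auto simp: Gal_mult compose_eq)
      also have "\<dots> = f" unfolding f_def
      proof (rule prod.reindex_bij_betw)
        show "bij_betw (\<lambda>\<tau>. \<sigma> \<otimes>\<^bsub>Gal L F\<^esub> \<tau>) (carrier (Gal L F)) (carrier (Gal L F))"
          using s by (intro bij_betw_byWitness[where f' = "\<lambda>g. inv\<^bsub>Gal L F\<^esub> \<sigma> \<otimes>\<^bsub>Gal L F\<^esub> g"])
            (auto simp: G.m_assoc[symmetric])
      qed
      finally show ?thesis .
    qed
    then have "coeff f i \<in> L" using G.one_closed by blast
    with * show ?thesis using fix_eq by blast
  qed
  show roots: "poly f z = 0 \<longleftrightarrow> (\<exists>\<tau>\<in>carrier (Gal L F). z = \<tau> x)" for z
    unfolding f_def using fin by (auto simp: poly_prod prod_zero_iff)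
  have "\<one>\<^bsub>Gal L F\<^esub> x = x" using x by (simp add: Gal_one)
  then show "poly f x = 0" unfolding roots using G.one_closed by metis
  show "f \<noteq> 0" unfolding f_def using fin by (simp add: prod_zero_iff)
  show "degree f = card (carrier (Gal L F))"
    unfolding f_def by (subst degree_prod_eq_sum_degree) auto
qed

text \<open>
  The image of \<open>x\<close> is again a root of the orbit polynomial of \<open>x\<close>, all of whose roots are in \<open>k\<close>.
\<close>

lemma galois_subfield_stable:
  assumes gal: "finite_galois_extension F k" and L: "subfield L CC" "k \<subseteq> L"
    and s: "\<sigma> \<in> carrier (Gal L F)" and x: "x \<in> k"
  shows "\<sigma> x \<in> k"
proof -
  have sub: "F \<subseteq> k" using gal by (auto simp: finite_galois_extension_def finite_extension_def)
  have \<sigma>0: "\<sigma> 0 = 0" using GalD(6)[OF s, of 0 0] subfield_closed[OF L(1)] by simp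
  note f = orbit_polynomial[OF gal x]
  have "poly (\<Prod>\<tau>\<in>carrier (Gal k F). [:- \<tau> x, 1:]) (\<sigma> x) = 0"
    using poly_automorphism[OF L(1) _ s f(1), of x] sub L x f(3) \<sigma>0 by auto
  then obtain \<tau> where "\<tau> \<in> carrier (Gal k F)" "\<sigma> x = \<tau> x" unfolding f(2) by blast
  then show ?thesis using GalD(1) x by metis
qed

text \<open>
  As there are no intermediate fields, \<open>L = F(x)\<close> for any \<open>x\<close> outside \<open>F\<close>, so the minimal polynomial
  \<open>p\<close> of \<open>x\<close> has degree \<open>[L:F]\<close>. This is at most the degree of the polynomial of the orbit of \<open>x\<close>,
  that is, the order of the Galois group. Conversely, the images of \<open>x\<close> are roots of \<open>p\<close>, and they are
  pairwise distinct: the field on which two automorphisms with the same value at \<open>x\<close> agree contains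
  \<open>x\<close>, so it is \<open>L\<close>.
\<close>

lemma card_Gal_prime_degree:
  assumes gal: "finite_galois_extension F L" and q: "Factorial_Ring.prime (degree_over F L)"
  shows "card (carrier (Gal L F)) = degree_over F L"
proof -
  have FL: "finite_extension F L" using gal by (simp add: finite_galois_extension_def)
  have F: "subfield F CC" and L: "subfield L CC" and sub: "F \<subseteq> L"
    using FL by (auto simp: finite_extension_def)
  have "degree_over F F = 1"
    using ring.dimI[OF CC_ring F ring.dimension_one[OF CC_ring F]] by (simp add: degree_over_def over_def)
  then have "F \<noteq> L" using q by auto
  then obtain x where x: "x \<in> L" "x \<notin> F" using sub by blast
  obtain p where p: "\<And>i. coeff p i \<in> F" "p \<noteq> 0" "poly p x = 0"
    "\<And>r. (\<And>i. coeff r i \<in> F) \<Longrightarrow> r \<noteq> 0 \<Longrightarrow> poly r x = 0 \<Longrightarrow> degree p \<le> degree r"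
    "degree p = degree_over F (ring.simple_extension CC F x)"
    "subfield (ring.simple_extension CC F x) CC"
    using minimal_polynomial_exists[OF FL x(1)] by metis
  let ?E = "ring.simple_extension CC F x"
  have "F \<subseteq> ?E" using ring.simple_extension_incl[OF CC_ring] by simp
  moreover have "x \<in> ?E" using ring.simple_extension_mem[OF CC_ring subfieldE(1)[OF F]] by simp
  moreover have "?E \<subseteq> L"
    using ring.simple_extension_subring_incl[OF CC_ring subfieldE(1)[OF L] sub x(1)] .
  ultimately have "?E = L" using no_intermediate_field_of_prime_degree[OF FL q p(6)] x by blast
  then have deg: "degree p = degree_over F L" using p(5) by simp
  note f = orbit_polynomial[OF gal x(1)]
  have "degree p \<le> card (carrier (Gal L F))"
    using p(4)[OF f(1) f(5) f(3)] f(4) by simp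
  moreover have "card (carrier (Gal L F)) \<le> degree p"
  proof -
    have inj: "inj_on (\<lambda>\<tau>. \<tau> x) (carrier (Gal L F))"
    proof (rule inj_onI)
      fix \<sigma> \<tau> assume s: "\<sigma> \<in> carrier (Gal L F)" and t: "\<tau> \<in> carrier (Gal L F)" and eq: "\<sigma> x = \<tau> x"
      let ?D = "{y \<in> L. \<sigma> y = \<tau> y}"
      have zero: "\<rho> 0 = 0" if "\<rho> \<in> carrier (Gal L F)" for \<rho>
        using GalD(6)[OF that, of 0 0] subfield_closed[OF L] by simp
      have neg: "\<rho> (- y) = - \<rho> y" if "\<rho> \<in> carrier (Gal L F)" "y \<in> L" for \<rho> y
        using GalD(6)[OF that(1), of y "- y"] zero[OF that(1)] that subfield_closed[OF L]
        by (simp add: eq_neg_iff_add_eq_0 add.commute)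
      have inv: "\<rho> (inverse y) = inverse (\<rho> y)" if "\<rho> \<in> carrier (Gal L F)" "y \<in> L" "y \<noteq> 0" for \<rho> y
        using GalD(5)[OF that(1), of y "inverse y"] GalD(7)[OF that(1)] that subfield_inverse[OF L that(2)]
        by (simp add: inverse_unique)
      have "subfield ?D CC"
        using subfield_closed[OF L] subfield_inverse[OF L] GalD[OF s] GalD[OF t]
          zero[OF s] zero[OF t] neg[OF s] neg[OF t] inv[OF s] inv[OF t]
        by (intro subfieldI_closed) auto
      moreover have "F \<subseteq> ?D" using GalD(8)[OF s] GalD(8)[OF t] sub by auto
      moreover have "x \<in> ?D" using x eq by simp
      ultimately have "?D = L"
        using no_intermediate_field_of_prime_degree[OF FL q, of ?D] x by blast
      then have "\<sigma> y = \<tau> y" if "y \<in> L" for y using that by blast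
      then show "\<sigma> = \<tau>" using GalD(2)[OF s] GalD(2)[OF t] by (rule_tac extensionalityI) auto
    qed
    have "(\<lambda>\<tau>. \<tau> x) ` carrier (Gal L F) \<subseteq> {z. poly p z = 0}"
    proof clarify
      fix \<tau> assume t: "\<tau> \<in> carrier (Gal L F)"
      have "\<tau> 0 = 0" using GalD(6)[OF t, of 0 0] subfield_closed[OF L] by simp
      then show "poly p (\<tau> x) = 0" using poly_automorphism[OF L sub t p(1) x(1)] p(3) by simp
    qed
    then have "card (carrier (Gal L F)) \<le> card {z. poly p z = 0}"
      using card_inj_on_le[OF inj] poly_roots_finite[OF p(2)] by blast
    also have "\<dots> \<le> degree p" using card_poly_roots_bound[OF p(2)] by blast
    finally show ?thesis .
  qed
  ultimately show ?thesis using deg by simp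
qed

section \<open>Irreducible characters over a Galois subfield of prime degree\<close>

text \<open>
  The group is cyclic, and a generator \<open>t\<close> is sent to a nontrivial \<open>q\<close>-th root of unity \<open>\<omega>\<close>. The
  exponent \<open>l g\<close> is any logarithm of \<open>g\<close> to the base \<open>t\<close>; the powers of \<open>\<omega>\<close> depend only on its
  class modulo \<open>q\<close>.
\<close>

lemma faithful_character_of_prime_order_group:
  fixes G (structure)
  assumes G: "group G" and q: "Factorial_Ring.prime q" and card: "card (carrier G) = q"
  obtains \<eta> :: "'a \<Rightarrow> complex"
  where "\<And>g h. g \<in> carrier G \<Longrightarrow> h \<in> carrier G \<Longrightarrow> \<eta> (g \<otimes>\<^bsub>G\<^esub> h) = \<eta> g * \<eta> h"
    "\<And>g. g \<in> carrier G \<Longrightarrow> \<eta> g ^ q = 1"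
    "\<And>g. g \<in> carrier G \<Longrightarrow> \<eta> g = 1 \<longleftrightarrow> g = \<one>\<^bsub>G\<^esub>"
proof -
  interpret group G by (rule G)
  have q2: "q \<ge> 2" using q by (rule prime_ge_2_nat)
  have fin: "finite (carrier G)" using card q2 by (intro card_ge_0_finite) simp
  obtain \<omega> :: complex where \<omega>: "\<omega> ^ q = 1" "\<omega> \<noteq> 1"
  proof -
    have "card {z :: complex. z ^ q = 1} = q" using q2 by (intro card_nth_roots) auto
    moreover have "card {z :: complex. z ^ q = 1} \<le> card {1 :: complex}" if "{z :: complex. z ^ q = 1} \<subseteq> {1}"
      using that by (intro card_mono) auto
    ultimately have "\<not> {z :: complex. z ^ q = 1} \<subseteq> {1}" using q2 by auto
    then show ?thesis using that by blast
  qed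
  obtain t where t: "t \<in> carrier G" "t \<noteq> \<one>"
  proof -
    have "card (carrier G) \<le> card {\<one>}" if "carrier G \<subseteq> {\<one>}"
      using that by (intro card_mono) auto
    then have "\<not> carrier G \<subseteq> {\<one>}" using q2 card by auto
    then show ?thesis using that by blast
  qed
  have "ord t dvd q"
    using ord_dvd_group_order[OF t(1)] by (simp only: Coset.order_def card)
  moreover have "ord t \<noteq> 1" using ord_eq_1[OF t(1)] t(2) by blast
  ultimately have ord: "ord t = q" using q unfolding prime_nat_iff by blast
  have powers: "(\<lambda>i. t [^] i) ` {0..q - 1} = carrier G"
  proof (rule card_subset_eq[OF fin])
    show "(\<lambda>i. t [^] i) ` {0..q - 1} \<subseteq> carrier G" using t by auto
    show "card ((\<lambda>i. t [^] i) ` {0..q - 1}) = card (carrier G)"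
      using ord_inj[OF t(1)] q2 unfolding ord card by (subst card_image) auto
  qed
  have "\<exists>i::nat. t [^] i = g" if "g \<in> carrier G" for g
    using that unfolding powers[symmetric] by (elim imageE) blast
  then obtain l :: "'a \<Rightarrow> nat" where l: "\<And>g. g \<in> carrier G \<Longrightarrow> t [^] l g = g" by metis
  have mod: "\<omega> ^ i = \<omega> ^ (i mod q)" for i
  proof -
    have "\<omega> ^ i = \<omega> ^ (q * (i div q) + i mod q)" by simp
    also have "\<dots> = \<omega> ^ (i mod q)" unfolding power_add power_mult \<omega>(1) by simp
    finally show ?thesis .
  qed
  have eq: "\<omega> ^ i = \<omega> ^ j" if "t [^] i = t [^] j" for i j :: nat
  proof -
    have "int q dvd int j - int i"
      using int_pow_eq[OF t(1), of "int i" "int j"] that by (simp add: int_pow_int ord)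
    then have "int j mod int q = int i mod int q" by (simp add: mod_eq_dvd_iff)
    then have "i mod q = j mod q" by (metis of_nat_eq_iff of_nat_mod)
    then show ?thesis using mod[of i] mod[of j] by simp
  qed
  define \<eta> where "\<eta> g = \<omega> ^ l g" for g
  show ?thesis
  proof (rule that[of \<eta>])
    fix g h assume gh: "g \<in> carrier G" "h \<in> carrier G"
    have "t [^] l (g \<otimes> h) = g \<otimes> h" by (rule l) (use gh in simp)
    also have "\<dots> = t [^] l g \<otimes> t [^] l h" by (simp only: l[OF gh(1)] l[OF gh(2)])
    also have "\<dots> = t [^] (l g + l h)" by (rule nat_pow_mult[OF t(1)])
    finally have "\<omega> ^ l (g \<otimes> h) = \<omega> ^ (l g + l h)" by (rule eq)
    then show "\<eta> (g \<otimes> h) = \<eta> g * \<eta> h" by (simp only: \<eta>_def power_add)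
  next
    fix g assume g: "g \<in> carrier G"
    have "\<eta> g ^ q = (\<omega> ^ q) ^ l g" unfolding \<eta>_def power_mult[symmetric] by (simp only: mult.commute)
    then show "\<eta> g ^ q = 1" by (simp add: \<omega>(1))
    show "\<eta> g = 1 \<longleftrightarrow> g = \<one>"
    proof
      assume "\<eta> g = 1"
      then have 1: "\<omega> ^ (l g mod q) = 1" by (simp only: \<eta>_def mod[symmetric])
      have "l g mod q = 0"
      proof (rule ccontr)
        assume "l g mod q \<noteq> 0"
        then show False
          using prime_root_of_unity_pow_eq_1[OF q \<omega>(1) _ _ 1] \<omega>(2) q2 by simp
      qed
      then have "t [^] l g = \<one>" using pow_eq_id[OF t(1)] ord by (simp add: mod_eq_0_iff_dvd)
      then show "g = \<one>" by (simp only: l[OF g])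
    next
      assume "g = \<one>"
      then have "t [^] l g = t [^] (0::nat)" using l[OF g] by (metis nat_pow_0)
      then have "\<omega> ^ l g = \<omega> ^ 0" by (rule eq)
      then show "\<eta> g = 1" by (simp add: \<eta>_def)
    qed
  qed
qed

text \<open>
  The restriction maps \<open>k\<close> into \<open>k\<close>, and so does the restriction of the inverse automorphism, which
  gives surjectivity.
\<close>

lemma restriction_to_galois_subfield:
  assumes gal: "finite_galois_extension F k" and L: "subfield L CC" "k \<subseteq> L"
    and s: "\<sigma> \<in> carrier (Gal L F)"
  shows "restrict \<sigma> k \<in> carrier (Gal k F)"
proof -
  have sub: "F \<subseteq> k" and k: "subfield k CC"
    using gal by (auto simp: finite_galois_extension_def finite_extension_def)
  interpret G: group "Gal L F" using Gal_group L sub by blast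
  let ?i = "inv\<^bsub>Gal L F\<^esub> \<sigma>"
  have i: "?i \<in> carrier (Gal L F)" using s by simp
  have st: "\<tau> x \<in> k" if "\<tau> \<in> carrier (Gal L F)" "x \<in> k" for \<tau> x
    using galois_subfield_stable[OF gal L that] .
  have "\<sigma> (?i x) = x" if "x \<in> k" for x
  proof -
    have "(\<sigma> \<otimes>\<^bsub>Gal L F\<^esub> ?i) x = x" using s L that by (simp add: Gal_one subsetD)
    then show ?thesis using that L by (simp add: Gal_mult[OF s i] compose_eq subsetD)
  qed
  then have "bij_betw (restrict \<sigma> k) k k"
    unfolding bij_betw_def using st[OF s] st[OF i] inj_on_subset[OF GalD(3)[OF s] L(2)]
    by (auto simp: inj_on_def image_iff) (metis)
  then show ?thesis
    unfolding Gal_carrier_iff using GalD[OF s] subfield_closed[OF k] L(2) sub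
    by (auto simp: Bij_def subset_iff)
qed

text \<open>
  The group of \<open>L\<close> over \<open>k\<close> is the kernel of the character \<open>\<psi>\<close> of the group of \<open>L\<close> over \<open>F\<close>
  that first restricts an automorphism to \<open>k\<close>.
\<close>

theorem irreducible_character_over_galois_subfield:
  assumes FL: "finite_extension F L" and gal: "finite_galois_extension F k" and kL: "k \<subseteq> L"
    and q: "Factorial_Ring.prime (degree_over F k)" and \<chi>: "\<chi> \<in> Irr (Gal L F)"
  shows "Res (Gal L k) \<chi> \<in> Irr (Gal L k) \<or> (\<exists>\<theta> \<in> Irr (Gal L k). \<chi> = Ind (Gal L F) (Gal L k) \<theta>)"
proof -
  have L: "subfield L CC" and FsubL: "F \<subseteq> L" using FL by (auto simp: finite_extension_def)
  have k: "subfield k CC" and Fk: "F \<subseteq> k"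
    using gal by (auto simp: finite_galois_extension_def finite_extension_def)
  obtain d \<rho> where irr: "irreducible_representation (Gal L F) d \<rho>"
    and \<chi>_eq: "\<chi> = (\<lambda>g\<in>carrier (Gal L F). mat_trace (\<rho> g))"
    using \<chi> by (auto simp: Irr_def)
  obtain \<eta> where \<eta>: "\<And>g h. g \<in> carrier (Gal k F) \<Longrightarrow> h \<in> carrier (Gal k F) \<Longrightarrow> \<eta> (g \<otimes>\<^bsub>Gal k F\<^esub> h) = \<eta> g * \<eta> h"
    "\<And>g. g \<in> carrier (Gal k F) \<Longrightarrow> \<eta> g ^ degree_over F k = 1"
    "\<And>g. g \<in> carrier (Gal k F) \<Longrightarrow> \<eta> g = (1::complex) \<longleftrightarrow> g = \<one>\<^bsub>Gal k F\<^esub>"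
    using faithful_character_of_prime_order_group[OF Gal_group[OF k Fk] q card_Gal_prime_degree[OF gal q]]
    by metis
  define \<psi> where "\<psi> \<sigma> = \<eta> (restrict \<sigma> k)" for \<sigma>
  note rk = restriction_to_galois_subfield[OF gal L kL]
  have ker: "\<psi> \<sigma> = 1 \<longleftrightarrow> \<sigma> \<in> carrier (Gal L k)" if s: "\<sigma> \<in> carrier (Gal L F)" for \<sigma>
  proof -
    have "\<psi> \<sigma> = 1 \<longleftrightarrow> restrict \<sigma> k = (\<lambda>x\<in>k. x)"
      unfolding \<psi>_def using \<eta>(3)[OF rk[OF s]] by (simp add: Gal_one)
    also have "\<dots> \<longleftrightarrow> (\<forall>x\<in>k. \<sigma> x = x)" by (auto simp: restrict_def fun_eq_iff)
    also have "\<dots> \<longleftrightarrow> \<sigma> \<in> carrier (Gal L k)" using s by (auto simp: Gal_carrier_iff)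
    finally show ?thesis .
  qed
  have sub: "carrier (Gal L k) \<subseteq> carrier (Gal L F)"
    using Fk unfolding Gal_carrier_iff subset_iff by blast
  show ?thesis
  proof (cases "\<exists>\<sigma>\<in>carrier (Gal L F). \<psi> \<sigma> \<noteq> 1")
    case False
    then have "carrier (Gal L k) = carrier (Gal L F)" using ker sub by blast
    then have eq: "Gal L k = Gal L F" by (simp add: Gal_def)
    have "Res (Gal L k) \<chi> = \<chi>" unfolding eq by (simp add: Res_def \<chi>_eq)
    then show ?thesis using \<chi> eq by simp
  next
    case True
    interpret group "Gal L F" using Gal_group[OF L FsubL] .
    interpret character_of_prime_order "Gal L F" d \<rho> \<psi> "degree_over F k"
    proof unfold_locales
      show "finite (carrier (Gal L F))" using Gal_finite[OF FL] .
      show "\<rho> \<in> hom (Gal L F) (GL d)" "d > 0" using irr by (auto simp: irreducible_representation_def)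
      show "W = {0\<^sub>v d} \<or> W = carrier_vec d"
        if "subspace class_ring W (module_vec TYPE(complex) d)"
          "\<And>g w. g \<in> carrier (Gal L F) \<Longrightarrow> w \<in> W \<Longrightarrow> \<rho> g *\<^sub>v w \<in> W" for W
        using irr that unfolding irreducible_representation_def by blast
      show "Factorial_Ring.prime (degree_over F k)" by (rule q)
      show "\<exists>g\<in>carrier (Gal L F). \<psi> g \<noteq> 1" by (rule True)
      fix \<sigma> assume s: "\<sigma> \<in> carrier (Gal L F)"
      show "\<psi> \<sigma> ^ degree_over F k = 1" unfolding \<psi>_def using \<eta>(2)[OF rk[OF s]] .
      fix \<tau> assume t: "\<tau> \<in> carrier (Gal L F)"
      have "restrict (\<sigma> \<otimes>\<^bsub>Gal L F\<^esub> \<tau>) k = restrict \<sigma> k \<otimes>\<^bsub>Gal k F\<^esub> restrict \<tau> k"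
        unfolding Gal_mult[OF s t] Gal_mult[OF rk[OF s] rk[OF t]]
        using kL galois_subfield_stable[OF gal L kL t]
        by (auto simp: compose_def restrict_def fun_eq_iff)
      then show "\<psi> (\<sigma> \<otimes>\<^bsub>Gal L F\<^esub> \<tau>) = \<psi> \<sigma> * \<psi> \<tau>"
        unfolding \<psi>_def using \<eta>(1)[OF rk[OF s] rk[OF t]] by simp
    qed
    have "carrier (Gal L k) = char_kernel" using ker sub by (auto simp: char_kernel_def)
    moreover have "monoid.mult (Gal L k) = monoid.mult (Gal L F)" by (simp add: Gal_def)
    ultimately show ?thesis using restriction_irreducible_or_induced[of "Gal L k"] \<chi>_eq by simp
  qed
qed

lemma p_class_field_tower_finite:
  assumes K: "finite_extension F K" and T: "p_class_field_tower p K T"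
  shows "finite_extension F (T n) \<and> K \<subseteq> T n"
proof (induction n)
  case 0
  show ?case using T K by (simp add: p_class_field_tower_def)
next
  case (Suc n)
  have "hilbert_p_class_field p (T n) (T (Suc n))"
    using T unfolding p_class_field_tower_def by (metis diff_Suc_1 le_add1 plus_1_eq_Suc)
  then have ext: "finite_extension (T n) (T (Suc n))"
    by (simp add: hilbert_p_class_field_def unramified_abelian_p_extension_def finite_galois_extension_def)
  then have "T n \<subseteq> T (Suc n)" by (simp add: finite_extension_def)
  then show ?case using Suc finite_extension_trans[OF _ ext] by blast
qed

theorem proposition7:
  fixes p q n :: nat
    and K k :: "complex set"
    and Kn :: "nat \<Rightarrow> complex set"
    and \<chi> :: "(complex \<Rightarrow> complex) \<Rightarrow> complex"
  assumes "Factorial_Ring.prime p"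
    and "finite_galois_extension \<rat> K"
    and "infinite_p_class_field_tower p K"
    and "k \<subseteq> K"
    and "finite_galois_extension \<rat> k"
    and "Factorial_Ring.prime q"
    and "degree_over \<rat> k = q"
    and "p_class_field_tower p K Kn"
    and "\<chi> \<in> Irr (Gal (Kn n) \<rat>)"
  shows "(\<exists>\<theta> \<in> Irr (Gal (Kn n) k). Res (Gal (Kn n) k) \<chi> = \<theta>)
       \<or> (\<exists>\<theta> \<in> Irr (Gal (Kn n) k). \<chi> = Ind (Gal (Kn n) \<rat>) (Gal (Kn n) k) \<theta>)"
proof -
  have "finite_extension \<rat> K" using assms(2) by (simp add: finite_galois_extension_def)
  note T = p_class_field_tower_finite[OF this assms(8), of n]
  show ?thesis
    using irreducible_character_over_galois_subfield[of \<rat> "Kn n" k \<chi>] T assms by blast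
qed

end
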